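(* Let $D$ be a binary delta-matroid on a finite set $E$, and let $Z_3(D,\tau)$, $\tau=(T_1,T_2,T_3)$, be its associated tight $3$-matroid. For a circuit $C$ of $Z_3(D,\tau)$ put $p_i(C)=|C\cap T_i| \bmod 2$ for $i\in\{1,2,3\}$. For $\beta=(\beta_1,\beta_2,\beta_3)\in\mathbb F_2^3$ let $P_\beta(D)$ be the condition $$\beta_1p_1(C)+\beta_2p_2(C)+\beta_3p_3(C)=0\ \text{ in }\mathbb F_2\quad\text{for every circuit } C \text{ of } Z_3(D,\tau),$$ and define $$X(D)=\{\beta\in\mathbb F_2^3: P_\beta(D)\text{ holds}\}.$$ Then $X(D)$ is a vector subspace of $\mathbb F_2^3$. Consequently, labelling the following seven properties by the nonzero vectors of $\mathbb F_2^3$, - $001$: $D$ is even; - $010$: $D^{+}$ is even; - $011$: $D$ is bipartite; - $100$: $D^{*+}$ is even; - $101$: $D^{*}$ is bipartite; - $110$: $D^{+*}$ is bipartite; - $111$: $D$ is $Z_3$-bipartite; the set of labels of those properties that $D$ satisfies is exactly $X(D)\setminus\{000\}$ (which may be empty).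
   Context: All sets are finite; $\triangle$ is symmetric difference. Delta-matroids. A set system is a pair $(E,\mathcal F)$ with $\mathcal F\subseteq 2^E$ (the feasible sets). A delta-matroid is a set system $D=(E,\mathcal F)$ with $\mathcal F\ne\varnothing$ such that for all $X,Y\in\mathcal F$ and $u\in X\triangle Y$ there is $v\in X\triangle Y$ (possibly $v=u$) with $X\triangle\{u,v\}\in\mathcal F$. $D$ is even if all feasible sets have the same parity of cardinality. $D_{\min}$ is the matroid on $E$ whose bases are the feasible sets of minimum cardinality; $D$ is bipartite if every circuit of $D_{\min}$ has even cardinality. Twist: $D*X=(E,\{F\triangle X:F\in\mathcal F\})$ for $X\subseteq E$. Loop complementation at $e\in E$: $D+e=(E,\mathcal F\triangle\{F\cup\{e\}:F\in\mathcal F,\ e\notin F\})$; these commute for distinct elements, and $D+X$ denotes applying $+e$ for all $e\in X$. Write $D^*=D*E$, $D^+=D+E$, $D^{+*}=(D+E)*E$, $D^{*+}=(D*E)+E$. For a symmetric matrix $A$ over $\mathbb F_2$ indexed by $E$, $D(A)=(E,\{X\subseteq E: A[X]\text{ nonsingular}\})$, where $A[X]$ is the principal submatrix and the empty matrix is nonsingular. $D$ is binary if some twist of $D$ is isomorphic to some such $D(A)$. Multimatroids. A carrier $(U,\Omega)$ is a set $U$ with a partition $\Omega$ into skew classes. A subtransversal (transversal) meets each skew class in at most (exactly) one element. A multimatroid $Z=(U,\Omega,\mathcal I)$ has $\mathcal I$ a family of subtransversals (independent sets) such that (1) for each transversal $T$, $\mathcal I\cap 2^T$ is the family of independent sets of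 a matroid on $T$; (2) for every $I\in\mathcal I$ and every two distinct elements $x,y$ of one skew class disjoint from $I$, $I\cup\{x\}\in\mathcal I$ or $I\cup\{y\}\in\mathcal I$. Bases are the maximal independent sets; circuits are the minimal subtransversals that are not independent. For $X\subseteq U$, $Z-X$ is the multimatroid on $U\setminus X$, with skew classes the nonempty sets $\omega\setminus X$, whose independent sets are those of $Z$ contained in $U\setminus X$. A $3$-matroid is a multimatroid all of whose skew classes have size $3$; it is tight if for every basis $X$ and skew class $\omega$, exactly one of the transversals $(X\setminus\omega)\cup\{u\}$, $u\in\omega$, is not a basis. The tight $3$-matroid $Z_3(D,\tau)$. For each $e\in E$ let $\omega_e=\{e_1,e_2,e_3\}$ (pairwise disjoint), $U=\bigcup_e\omega_e$, $\Omega=\{\omega_e:e\in E\}$, $T_i=\{e_i:e\in E\}$, $\tau=(T_1,T_2,T_3)$. For a tight $3$-matroid $Z$ on $(U,\Omega)$, $D_{Z,\tau}$ is the set system on $E$ in which $X$ is feasible iff $\{e_1:e\in E\setminus X\}\cup\{e_2:e\in X\}$ is a basis of $Z-T_3$. For a binary delta-matroid $D$ it is known that there is a unique tight $3$-matroid $Z$ on $(U,\Omega)$ with $D=D_{Z,\tau}$; it is denoted $Z_3(D,\tau)$. $D$ is $Z_3$-bipartite if every circuit of $Z_3(D,\tau)$ has even cardinality. *)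

theory Defs
  imports
    "HOL-Analysis.Cartesian_Space"
    "HOL-Library.Z2"
    "HOL-Library.Disjoint_Sets"
begin

section \<open>Matroids\<close>

text \<open>A matroid is a pair of a ground set and its family of independent sets.\<close>

definition matroid :: "'a set \<times> 'a set set \<Rightarrow> bool" where
  "matroid M \<longleftrightarrow> (case M of (E, \<I>) \<Rightarrow>
     finite E \<and> \<I> \<subseteq> Pow E \<and> {} \<in> \<I> \<and>
     (\<forall>I\<in>\<I>. \<forall>J. J \<subseteq> I \<longrightarrow> J \<in> \<I>) \<and>
     (\<forall>I\<in>\<I>. \<forall>J\<in>\<I>. card I < card J \<longrightarrow> (\<exists>x\<in>J - I. insert x I \<in> \<I>)))"

definition matroid_circuits :: "'a set \<times> 'a set set \<Rightarrow> 'a set set" where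
  "matroid_circuits M = (case M of (E, \<I>) \<Rightarrow>
     {C. C \<subseteq> E \<and> C \<notin> \<I> \<and> (\<forall>C'. C' \<subset> C \<longrightarrow> C' \<in> \<I>)})"

section \<open>Set systems and delta-matroids\<close>

record 'a set_system =
  ground :: "'a set"
  feasible :: "'a set set"

definition delta_matroid :: "'a set_system \<Rightarrow> bool" where
  "delta_matroid D \<longleftrightarrow>
     finite (ground D) \<and> feasible D \<subseteq> Pow (ground D) \<and> feasible D \<noteq> {} \<and>
     (\<forall>X\<in>feasible D. \<forall>Y\<in>feasible D. \<forall>u\<in>sym_diff X Y.
        \<exists>v\<in>sym_diff X Y. sym_diff X {u, v} \<in> feasible D)"

definition even_system :: "'a set_system \<Rightarrow> bool" where
  "even_system D \<longleftrightarrow> (\<forall>X\<in>feasible D. \<forall>Y\<in>feasible D. even (card X) = even (card Y))"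

definition min_feasible :: "'a set_system \<Rightarrow> 'a set set" where
  "min_feasible D = {B \<in> feasible D. \<forall>F\<in>feasible D. card B \<le> card F}"

definition D_min :: "'a set_system \<Rightarrow> 'a set \<times> 'a set set" where
  "D_min D = (ground D, {I. \<exists>B\<in>min_feasible D. I \<subseteq> B})"

definition bipartite :: "'a set_system \<Rightarrow> bool" where
  "bipartite D \<longleftrightarrow> (\<forall>C\<in>matroid_circuits (D_min D). even (card C))"

definition twist :: "'a set_system \<Rightarrow> 'a set \<Rightarrow> 'a set_system" where
  "twist D X = \<lparr>ground = ground D, feasible = (\<lambda>F. sym_diff F X) ` feasible D\<rparr>"

definition loop_compl1 :: "'a \<Rightarrow> 'a set_system \<Rightarrow> 'a set_system" where
  "loop_compl1 e D = \<lparr>ground = ground D,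
     feasible = sym_diff (feasible D) {F \<union> {e} |F. F \<in> feasible D \<and> e \<notin> F}\<rparr>"

text \<open>The operations \<^term>\<open>loop_compl1 e\<close> commute, so the fold below does not depend on an
  order of the elements of the finite set \<open>X\<close>.\<close>

definition loop_compl :: "'a set_system \<Rightarrow> 'a set \<Rightarrow> 'a set_system" where
  "loop_compl D X = Finite_Set.fold loop_compl1 D X"

definition dual :: "'a set_system \<Rightarrow> 'a set_system" where
  "dual D = twist D (ground D)"

definition plus_all :: "'a set_system \<Rightarrow> 'a set_system" where
  "plus_all D = loop_compl D (ground D)"

section \<open>Binary delta-matroids\<close>

text \<open>Matrices indexed by a set \<open>V\<close> are functions of which only the values on \<open>V \<times> V\<close> matter.
  Nonsingularity of \<open>A[X]\<close> is existence of a two-sided inverse, as in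
  \<^const>\<open>Finite_Cartesian_Product.invertible\<close>, with the index type replaced by the
  index set \<open>X\<close>. In particular the empty matrix is nonsingular.\<close>

definition nonsingular_on :: "'a set \<Rightarrow> ('a \<Rightarrow> 'a \<Rightarrow> bit) \<Rightarrow> bool" where
  "nonsingular_on X A \<longleftrightarrow>
     (\<exists>B. \<forall>i\<in>X. \<forall>j\<in>X.
        (\<Sum>k\<in>X. A i k * B k j) = (if i = j then 1 else 0) \<and>
        (\<Sum>k\<in>X. B i k * A k j) = (if i = j then 1 else 0))"

definition matrix_system :: "'a set \<Rightarrow> ('a \<Rightarrow> 'a \<Rightarrow> bit) \<Rightarrow> 'a set_system" where
  "matrix_system V A = \<lparr>ground = V, feasible = {X. X \<subseteq> V \<and> nonsingular_on X A}\<rparr>"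

definition isomorphic :: "'a set_system \<Rightarrow> 'b set_system \<Rightarrow> bool" where
  "isomorphic D D' \<longleftrightarrow>
     (\<exists>f. bij_betw f (ground D) (ground D') \<and> feasible D' = (\<lambda>F. f ` F) ` feasible D)"

text \<open>Taking \<open>V\<close> in the element type of \<open>D\<close> is no restriction, since \<open>V\<close> is
  equinumerous with the ground set of \<open>D\<close>.\<close>

definition binary :: "'a set_system \<Rightarrow> bool" where
  "binary D \<longleftrightarrow>
     (\<exists>X (V :: 'a set) A. X \<subseteq> ground D \<and> finite V \<and>
        (\<forall>i\<in>V. \<forall>j\<in>V. A i j = A j i) \<and>
        isomorphic (twist D X) (matrix_system V A))"

section \<open>Multimatroids\<close>

record 'u multimatroid =
  elements :: "'u set"
  skew_classes :: "'u set set"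
  indep :: "'u set set"

definition subtransversal :: "'u multimatroid \<Rightarrow> 'u set \<Rightarrow> bool" where
  "subtransversal Z S \<longleftrightarrow> S \<subseteq> elements Z \<and> (\<forall>\<omega>\<in>skew_classes Z. card (S \<inter> \<omega>) \<le> 1)"

definition transversal :: "'u multimatroid \<Rightarrow> 'u set \<Rightarrow> bool" where
  "transversal Z S \<longleftrightarrow> S \<subseteq> elements Z \<and> (\<forall>\<omega>\<in>skew_classes Z. card (S \<inter> \<omega>) = 1)"

definition multimatroid :: "'u multimatroid \<Rightarrow> bool" where
  "multimatroid Z \<longleftrightarrow>
     finite (elements Z) \<and> partition_on (elements Z) (skew_classes Z) \<and>
     (\<forall>I\<in>indep Z. subtransversal Z I) \<and>
     (\<forall>T. transversal Z T \<longrightarrow> matroid (T, indep Z \<inter> Pow T)) \<and>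
     (\<forall>I\<in>indep Z. \<forall>\<omega>\<in>skew_classes Z. \<omega> \<inter> I = {} \<longrightarrow>
        (\<forall>x\<in>\<omega>. \<forall>y\<in>\<omega>. x \<noteq> y \<longrightarrow> I \<union> {x} \<in> indep Z \<or> I \<union> {y} \<in> indep Z))"

definition bases :: "'u multimatroid \<Rightarrow> 'u set set" where
  "bases Z = {B \<in> indep Z. \<forall>I\<in>indep Z. B \<subseteq> I \<longrightarrow> I = B}"

definition circuits :: "'u multimatroid \<Rightarrow> 'u set set" where
  "circuits Z = {C. subtransversal Z C \<and> C \<notin> indep Z \<and>
     (\<forall>C'. C' \<subset> C \<and> subtransversal Z C' \<longrightarrow> C' \<in> indep Z)}"

definition delete :: "'u multimatroid \<Rightarrow> 'u set \<Rightarrow> 'u multimatroid" where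
  "delete Z X = \<lparr>elements = elements Z - X,
     skew_classes = {\<omega> - X |\<omega>. \<omega> \<in> skew_classes Z \<and> \<omega> - X \<noteq> {}},
     indep = {I \<in> indep Z. I \<subseteq> elements Z - X}\<rparr>"

definition tight_3_matroid :: "'u multimatroid \<Rightarrow> bool" where
  "tight_3_matroid Z \<longleftrightarrow>
     multimatroid Z \<and> (\<forall>\<omega>\<in>skew_classes Z. card \<omega> = 3) \<and>
     (\<forall>X\<in>bases Z. \<forall>\<omega>\<in>skew_classes Z. \<exists>!u. u \<in> \<omega> \<and> (X - \<omega>) \<union> {u} \<notin> bases Z)"

section \<open>The tight 3-matroid of a binary delta-matroid\<close>

text \<open>The element \<open>e\<^sub>i\<close> is \<open>t e i\<close>, with \<open>i\<close> in the three-element type \<^typ>\<open>3\<close>,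
  whose elements are \<open>1\<close>, \<open>2\<close> and \<open>3\<close> (and \<open>3 = 0\<close>).\<close>

definition labelling :: "'a set \<Rightarrow> ('a \<Rightarrow> 3 \<Rightarrow> 'u) \<Rightarrow> bool" where
  "labelling E t \<longleftrightarrow> inj_on (\<lambda>(e, i). t e i) (E \<times> UNIV)"

definition T_class :: "'a set \<Rightarrow> ('a \<Rightarrow> 3 \<Rightarrow> 'u) \<Rightarrow> 3 \<Rightarrow> 'u set" where
  "T_class E t i = {t e i |e. e \<in> E}"

text \<open>The set system \<open>D\<^bsub>Z,\<tau>\<^esub>\<close>.\<close>

definition system_of :: "'a set \<Rightarrow> ('a \<Rightarrow> 3 \<Rightarrow> 'u) \<Rightarrow> 'u multimatroid \<Rightarrow> 'a set_system" where
  "system_of E t Z = \<lparr>ground = E,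
     feasible = {X. X \<subseteq> E \<and>
       {t e 1 |e. e \<in> E - X} \<union> {t e 2 |e. e \<in> X} \<in> bases (delete Z (T_class E t 3))}\<rparr>"

definition Z3 :: "'a set_system \<Rightarrow> ('a \<Rightarrow> 3 \<Rightarrow> 'u) \<Rightarrow> 'u multimatroid" where
  "Z3 D t = (THE Z. tight_3_matroid Z \<and>
     elements Z = (\<Union>e\<in>ground D. {t e 1, t e 2, t e 3}) \<and>
     skew_classes Z = {{t e 1, t e 2, t e 3} |e. e \<in> ground D} \<and>
     system_of (ground D) t Z = D)"

definition Z3_bipartite :: "'a set_system \<Rightarrow> ('a \<Rightarrow> 3 \<Rightarrow> 'u) \<Rightarrow> bool" where
  "Z3_bipartite D t \<longleftrightarrow> (\<forall>C\<in>circuits (Z3 D t). even (card C))"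

section \<open>Parity conditions on circuits\<close>

definition parity :: "'a set_system \<Rightarrow> ('a \<Rightarrow> 3 \<Rightarrow> 'u) \<Rightarrow> 3 \<Rightarrow> 'u set \<Rightarrow> bit" where
  "parity D t i C = of_nat (card (C \<inter> T_class (ground D) t i))"

definition P_cond :: "bit ^ 3 \<Rightarrow> 'a set_system \<Rightarrow> ('a \<Rightarrow> 3 \<Rightarrow> 'u) \<Rightarrow> bool" where
  "P_cond \<beta> D t \<longleftrightarrow> (\<forall>C\<in>circuits (Z3 D t).
     \<beta> $ 1 * parity D t 1 C + \<beta> $ 2 * parity D t 2 C + \<beta> $ 3 * parity D t 3 C = 0)"

definition X_set :: "'a set_system \<Rightarrow> ('a \<Rightarrow> 3 \<Rightarrow> 'u) \<Rightarrow> (bit ^ 3) set" where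
  "X_set D t = {\<beta>. P_cond \<beta> D t}"

end

theory Submission
  imports Defs
begin

text \<open>
Everything is read off from one linear object. Identify the three elements of each skew class with
the three nonzero vectors of the symplectic plane over the field with two elements. A binary
delta-matroid \<open>D\<close> on \<open>E\<close> then determines a Lagrangian subspace \<open>L\<close> of the direct sum of the planes
over \<open>E\<close>, namely the graph \<open>{(x, A x)}\<close> of a symmetric matrix \<open>A\<close> whose two coordinates are swapped
over the set by which \<open>D\<close> has to be twisted (\<open>binary_imp_sys\<close>). A transversal is a basis of
\<open>Z\<^sub>3(D)\<close> when no nonzero vector of \<open>L\<close> is supported on it. The resulting multimatroid is tight
because a vector of \<open>L\<close> is isotropic to every other one (at most one non-basis in a skew class) and
because \<open>L\<close> has the maximal cardinality (at least one). A tight 3-matroid is determined by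
its bases that avoid \<open>T\<^sub>3\<close> (\<open>tight_3_matroid_unique\<close>), so it is the one chosen by \<^const>\<open>Z3\<close>.

For distinct nonzero vectors \<open>x\<close>, \<open>y\<close> of the plane let \<open>sys x y\<close> be the set system of the
bases with entries in \<open>{x, y}\<close>. Then \<open>D = sys x y\<close> for suitable \<open>x\<close>, \<open>y\<close>, duality exchanges \<open>x\<close> and
\<open>y\<close>, and loop complementation on all of \<open>E\<close> replaces \<open>y\<close> by \<open>x + y\<close>. So all the delta-matroids in
the theorem come from \<open>L\<close> by permuting the three vectors, and two facts about \<open>sys x y\<close>
suffice.

Evenness (\<open>even_sys_iff\<close>): \<open>sys x y\<close> is even if and only if every vector of \<open>L\<close> has an even number
of entries \<open>x + y\<close>. That number modulo 2 is a quadratic form whose polar form is the symplectic form,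
hence it is additive on \<open>L\<close>, and on the fundamental vectors of a basis it records whether
a single element can be added to or removed from a feasible set.

Bipartiteness (\<open>bipartite_sys_iff\<close>): the circuits of the lower matroid of \<open>sys x y\<close> are the minimal
nonempty sets among \<open>{e. v e \<notin> {0, x}}\<close> with \<open>v\<close> in \<open>L\<close>. Hence \<open>sys x y\<close> is bipartite if and only if
every vector of \<open>L\<close> has an even number of entries in \<open>{y, x + y}\<close>.

Finally, the circuits of \<open>Z\<^sub>3(D)\<close> are the minimal supports of nonzero vectors of \<open>L\<close>, and every support
is a disjoint union of circuits. So a parity condition holds on all circuits if and only if it
holds on all of \<open>L\<close> (\<open>P_cond_iff\<close>), which matches the conditions above one by one. The set \<open>X(D)\<close>
is a subspace because each condition is linear in \<open>\<beta>\<close>.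
\<close>

section \<open>The symplectic plane over the field with two elements\<close>

text \<open>Over two elements this form vanishes exactly on pairs that are equal or contain zero, so it does not
single out any of the three nonzero vectors. This symmetry is what allows to permute them below.\<close>

definition sform :: "bit \<times> bit \<Rightarrow> bit \<times> bit \<Rightarrow> bit" where
  "sform x y = fst x * snd y + snd x * fst y"

lemma bit_pair_cases:
  fixes x :: "bit \<times> bit"
  obtains "x = (0, 0)" | "x = (0, 1)" | "x = (1, 0)" | "x = (1, 1)"
  by (metis bit_not_zero_iff surj_pair)

lemma sform_eq: "sform x y = of_bool (x \<noteq> 0 \<and> y \<noteq> 0 \<and> x \<noteq> y)"
  by (cases x rule: bit_pair_cases; cases y rule: bit_pair_cases) (auto simp: sform_def zero_prod_def)

lemma sform_add_left: "sform (x + y) z = sform x z + sform y z"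
  unfolding sform_def by (simp only: fst_add snd_add distrib_left distrib_right ac_simps)

lemma bit_pair_add_self [simp]: "(x :: bit \<times> bit) + x = 0"
  by (simp add: prod_eq_iff)

lemma bit_pair_add_eq_0_iff: "(x :: bit \<times> bit) + y = 0 \<longleftrightarrow> x = y"
  by (cases x rule: bit_pair_cases; cases y rule: bit_pair_cases) (auto simp: zero_prod_def)

lemma bit_pair_third:
  fixes x y z :: "bit \<times> bit"
  assumes "x \<noteq> 0" "y \<noteq> 0" "x \<noteq> y"
  shows "z \<noteq> 0 \<and> z \<noteq> x \<and> z \<noteq> y \<longleftrightarrow> z = x + y"
  using assms
  by (cases x rule: bit_pair_cases; cases y rule: bit_pair_cases; cases z rule: bit_pair_cases)
    (auto simp: zero_prod_def)

text \<open>The indicator function of a nonzero vector is a quadratic form on the plane, and its polar form is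
the symplectic form whichever nonzero vector is taken.\<close>

lemma of_bool_add_eq_sform:
  fixes x y z :: "bit \<times> bit"
  assumes "z \<noteq> 0"
  shows "(of_bool (x + y = z) :: bit) = of_bool (x = z) + of_bool (y = z) + sform x y"
  using assms
  by (cases x rule: bit_pair_cases; cases y rule: bit_pair_cases; cases z rule: bit_pair_cases)
    (auto simp: zero_prod_def sform_def)

lemma of_nat_bit_eq: "(of_nat n :: bit) = of_bool (odd n)"
  by (induction n) auto

section \<open>Lagrangian subspaces and their bases\<close>

text \<open>An isotropic subspace has at most \<open>2 ^ card E\<close> elements, so \<open>card_L\<close> expresses that
\<open>L\<close> is maximal isotropic. Vectors vanish outside \<open>E\<close> in order that they are
determined by their entries on \<open>E\<close>.\<close>

locale lagrangian =
  fixes E :: "'a set" and L :: "('a \<Rightarrow> bit \<times> bit) set"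
  assumes finite_E: "finite E"
    and outside: "\<And>v e. v \<in> L \<Longrightarrow> e \<notin> E \<Longrightarrow> v e = 0"
    and zero_mem: "(\<lambda>_. 0) \<in> L"
    and add_mem: "\<And>v w. v \<in> L \<Longrightarrow> w \<in> L \<Longrightarrow> (\<lambda>e. v e + w e) \<in> L"
    and isotropic: "\<And>v w. v \<in> L \<Longrightarrow> w \<in> L \<Longrightarrow> (\<Sum>e\<in>E. sform (v e) (w e)) = 0"
    and card_L: "card L = 2 ^ card E"
begin

definition supported :: "('a \<Rightarrow> bit \<times> bit) \<Rightarrow> ('a \<Rightarrow> bit \<times> bit) \<Rightarrow> bool" where
  "supported v T \<longleftrightarrow> (\<forall>e\<in>E. v e = 0 \<or> v e = T e)"

text \<open>A choice \<open>T\<close> of a nonzero vector in every plane spans a Lagrangian subspace; it is a basis when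
this subspace meets \<open>L\<close> trivially.\<close>

definition basis :: "('a \<Rightarrow> bit \<times> bit) \<Rightarrow> bool" where
  "basis T \<longleftrightarrow> (\<forall>v\<in>L. supported v T \<longrightarrow> v = (\<lambda>_. 0))"

lemma vec_eqI: "v \<in> L \<Longrightarrow> w \<in> L \<Longrightarrow> (\<And>e. e \<in> E \<Longrightarrow> v e = w e) \<Longrightarrow> v = w"
  by (rule ext) (metis outside)

text \<open>In the sum that expresses isotropy all terms but one vanish, hence so does the remaining one. Most
proofs below end by applying this to two vectors that agree, where both are nonzero, in all
coordinates but one.\<close>

lemma isotropic_at:
  assumes "v \<in> L" "w \<in> L" "e \<in> E" "\<And>f. f \<in> E \<Longrightarrow> f \<noteq> e \<Longrightarrow> v f = 0 \<or> w f = 0 \<or> v f = w f"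
  shows "v e = 0 \<or> w e = 0 \<or> v e = w e"
proof -
  have "(\<Sum>f\<in>E. sform (v f) (w f)) = sform (v e) (w e) + (\<Sum>f\<in>E - {e}. sform (v f) (w f))"
    using assms(3) finite_E by (simp add: sum.remove)
  also have "(\<Sum>f\<in>E - {e}. sform (v f) (w f)) = 0"
    using assms(4) by (intro sum.neutral) (auto simp: sform_eq)
  finally show ?thesis
    using isotropic[OF assms(1,2)] by (auto simp: sform_eq split: if_splits)
qed

lemma basis_cong: "(\<And>e. e \<in> E \<Longrightarrow> T e = T' e) \<Longrightarrow> basis T = basis T'"
  by (simp add: basis_def supported_def)

text \<open>Sending \<open>v\<close> to the set of coordinates in which it leaves the line of \<open>T\<close> is additive, and it is
injective on \<open>L\<close> because \<open>T\<close> is a basis. Both sides have \<open>2 ^ card E\<close> elements, so singletons are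
attained.\<close>

lemma fundamental_vector:
  assumes T: "basis T" "\<And>e. e \<in> E \<Longrightarrow> T e \<noteq> 0" and e: "e \<in> E"
  obtains v where "v \<in> L" "v e \<noteq> 0" "v e \<noteq> T e" "\<And>f. f \<in> E \<Longrightarrow> f \<noteq> e \<Longrightarrow> v f = 0 \<or> v f = T f"
proof -
  define \<phi> where "\<phi> v = {e \<in> E. v e \<noteq> 0 \<and> v e \<noteq> T e}" for v
  have "inj_on \<phi> L"
  proof (rule inj_onI)
    fix v w assume vw: "v \<in> L" "w \<in> L" "\<phi> v = \<phi> w"
    have "supported (\<lambda>e. v e + w e) T"
      unfolding supported_def
    proof
      fix f assume f: "f \<in> E"
      have "sform (v f) (T f) = sform (w f) (T f)"
        using vw(3) f T(2)[OF f] unfolding \<phi>_def sform_eq by auto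
      then have "sform (v f + w f) (T f) = 0"
        by (simp add: sform_add_left)
      then show "v f + w f = 0 \<or> v f + w f = T f"
        using T(2)[OF f] by (auto simp: sform_eq)
    qed
    then have "(\<lambda>e. v e + w e) = (\<lambda>_. 0)"
      using T(1) add_mem[OF vw(1,2)] by (simp add: basis_def)
    then show "v = w"
      by (metis bit_pair_add_eq_0_iff ext)
  qed
  moreover have "\<phi> ` L \<subseteq> Pow E"
    by (auto simp: \<phi>_def)
  ultimately have "\<phi> ` L = Pow E"
    using finite_E by (intro card_subset_eq) (auto simp: card_image card_L card_Pow)
  then obtain v where "v \<in> L" "\<phi> v = {e}"
    using e by (metis (no_types, lifting) PowI empty_subsetI image_iff insert_subset)
  then show thesis
    by (intro that[of v]) (auto simp: \<phi>_def)
qed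

text \<open>This is tightness: when one entry of a basis \<open>T\<close> varies, the only value that destroys
the basis is the entry of the fundamental vector. Two supported vectors with different
entries there would not be isotropic.\<close>

lemma basis_change_iff:
  assumes T: "basis T" and v: "v \<in> L" "e \<in> E" "v e \<noteq> 0" "v e \<noteq> T e"
    "\<And>f. f \<in> E \<Longrightarrow> f \<noteq> e \<Longrightarrow> v f = 0 \<or> v f = T f" and x: "x \<noteq> 0"
  shows "basis (T(e := x)) \<longleftrightarrow> x \<noteq> v e"
proof
  assume "basis (T(e := x))"
  moreover have "x = v e \<Longrightarrow> supported v (T(e := x))"
    using v by (auto simp: supported_def)
  ultimately show "x \<noteq> v e"
    using v by (auto simp: basis_def)
next
  assume ne: "x \<noteq> v e"
  show "basis (T(e := x))"
    unfolding basis_def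
  proof (intro ballI impI)
    fix w assume w: "w \<in> L" "supported w (T(e := x))"
    have "v e = 0 \<or> w e = 0 \<or> v e = w e"
    proof (rule isotropic_at[OF v(1) w(1) v(2)])
      fix f assume f: "f \<in> E" "f \<noteq> e"
      then show "v f = 0 \<or> w f = 0 \<or> v f = w f"
        using v(5)[OF f] w(2) by (auto simp: supported_def)
    qed
    moreover have "w e = 0 \<or> w e = x"
      using w(2) v(2) by (auto simp: supported_def)
    ultimately have "w e = 0"
      using v(3) ne by auto
    then have "supported w T"
      using w(2) unfolding supported_def by (metis fun_upd_other)
    then show "w = (\<lambda>_. 0)"
      using T w(1) by (simp add: basis_def)
  qed
qed

text \<open>A pivot on two coordinates: the fundamental vector at \<open>e\<close> obstructs the change of \<open>T\<close> at \<open>e\<close>, and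
the obstruction disappears as soon as any other coordinate used by that vector is changed as well.\<close>

lemma basis_exchange:
  assumes T: "basis T" and v: "v \<in> L" "e \<in> E" "v e \<noteq> 0" "v e \<noteq> T e"
    "\<And>f. f \<in> E \<Longrightarrow> f \<noteq> e \<Longrightarrow> v f = 0 \<or> v f = T f"
    and g: "g \<in> E" "g \<noteq> e" "v g \<noteq> 0" and y: "y \<noteq> T g"
  shows "basis (T(e := v e, g := y))"
  unfolding basis_def
proof (intro ballI impI)
  fix w assume w: "w \<in> L" "supported w (T(e := v e, g := y))"
  have wE: "w f = 0 \<or> w f = (T(e := v e, g := y)) f" if "f \<in> E" for f
    using w(2) that by (simp add: supported_def)
  have we: "w e = 0 \<or> w e = v e"
    using wE[OF v(2)] g(2) by auto
  have "v g = 0 \<or> w g = 0 \<or> v g = w g"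
  proof (rule isotropic_at[OF v(1) w(1) g(1)])
    fix f assume f: "f \<in> E" "f \<noteq> g"
    then show "v f = 0 \<or> w f = 0 \<or> v f = w f"
      using v(5)[OF f(1)] wE[OF f(1)] by (cases "f = e") auto
  qed
  moreover have "v g = T g"
    using v(5) g by blast
  ultimately have wg: "w g = 0"
    using wE[OF g(1)] g(3) y by auto
  show "w = (\<lambda>_. 0)"
  proof (cases "w e = 0")
    case True
    have "supported w T"
      unfolding supported_def using wE wg True by (metis fun_upd_apply)
    then show ?thesis
      using T w(1) by (simp add: basis_def)
  next
    case False
    have "supported (\<lambda>f. v f + w f) T"
      unfolding supported_def
    proof
      fix f assume f: "f \<in> E"
      show "v f + w f = 0 \<or> v f + w f = T f"
        using v(5)[OF f] wE[OF f] we False wg by (cases "f = e"; cases "f = g") auto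
    qed
    then have "(\<lambda>f. v f + w f) = (\<lambda>_. 0)"
      using T add_mem[OF v(1) w(1)] by (simp add: basis_def)
    then have "v g = w g"
      by (metis bit_pair_add_eq_0_iff)
    then show ?thesis
      using g(3) wg by simp
  qed
qed

text \<open>The basis is built greedily, one coordinate at a time. If both values failed
at a coordinate, the two vectors witnessing this would have different nonzero entries there and agree
wherever else both are nonzero, against isotropy.\<close>

lemma partial_basis:
  assumes xy: "x \<noteq> 0" "y \<noteq> 0" "x \<noteq> y" and "F \<subseteq> E"
  shows "\<exists>X\<subseteq>F. \<forall>v\<in>L. supported v (\<lambda>e. if e \<in> X then y else x) \<and> (\<forall>e\<in>E - F. v e = 0) \<longrightarrow> v = (\<lambda>_. 0)"
  using finite_subset[OF \<open>F \<subseteq> E\<close> finite_E] \<open>F \<subseteq> E\<close>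
proof (induction F rule: finite_induct)
  case empty
  show ?case
    using vec_eqI[OF _ zero_mem] by auto
next
  case (insert a F)
  then obtain X where X: "X \<subseteq> F" and
    ind: "\<And>v. v \<in> L \<Longrightarrow> supported v (\<lambda>e. if e \<in> X then y else x) \<Longrightarrow> (\<forall>e\<in>E - F. v e = 0) \<Longrightarrow> v = (\<lambda>_. 0)"
    by auto
  have a: "a \<in> E" "a \<notin> X" using insert X by auto
  show ?case
  proof (rule ccontr)
    assume con: "\<not> ?thesis"
    from con X obtain v where v: "v \<in> L" "supported v (\<lambda>e. if e \<in> X then y else x)" 
      "\<forall>e\<in>E - insert a F. v e = 0" "v \<noteq> (\<lambda>_. 0)" by (metis subset_insertI2)
    from con X obtain w where w: "w \<in> L" "supported w (\<lambda>e. if e \<in> insert a X then y else x)" 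
      "\<forall>e\<in>E - insert a F. w e = 0" "w \<noteq> (\<lambda>_. 0)" by (metis insert_mono)
    have "v a \<noteq> 0"
      using ind[OF v(1,2)] v(3,4) by (metis Diff_iff insert_iff)
    then have va: "v a = x"
      using v(2) a by (auto simp: supported_def)
    have "w a \<noteq> 0"
    proof
      assume "w a = 0"
      then have "supported w (\<lambda>e. if e \<in> X then y else x)" "\<forall>e\<in>E - F. w e = 0"
        using w(2,3) by (simp_all add: supported_def) (metis, blast)
      then show False using ind w by blast
    qed
    then have wa: "w a = y"
      using w(2) a by (auto simp: supported_def)
    have "v a = 0 \<or> w a = 0 \<or> v a = w a"
    proof (rule isotropic_at[OF v(1) w(1) a(1)])
      fix f assume "f \<in> E" "f \<noteq> a"
      then show "v f = 0 \<or> w f = 0 \<or> v f = w f"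
        using bspec[OF v(2)[unfolded supported_def], of f] bspec[OF w(2)[unfolded supported_def], of f]
        by auto
    qed
    then show False using va wa xy by auto
  qed
qed

section \<open>The set systems of a Lagrangian subspace\<close>

definition sys :: "bit \<times> bit \<Rightarrow> bit \<times> bit \<Rightarrow> 'a set_system" where
  "sys x y = \<lparr>ground = E, feasible = {X. X \<subseteq> E \<and> basis (\<lambda>e. if e \<in> X then y else x)}\<rparr>"

lemma feasible_sys: "X \<in> feasible (sys x y) \<longleftrightarrow> X \<subseteq> E \<and> basis (\<lambda>e. if e \<in> X then y else x)"
  by (simp add: sys_def)

lemma ground_sys [simp]: "ground (sys x y) = E"
  by (simp add: sys_def)

lemma feasible_sys_nonempty:
  assumes "x \<noteq> 0" "y \<noteq> 0" "x \<noteq> y"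
  shows "feasible (sys x y) \<noteq> {}"
proof -
  obtain X where "X \<subseteq> E" "basis (\<lambda>e. if e \<in> X then y else x)"
    using partial_basis[OF assms order_refl] by (auto simp: basis_def)
  then show ?thesis
    using feasible_sys by blast
qed

lemma dual_sys: "dual (sys x y) = sys y x"
proof -
  have "(\<lambda>F. sym_diff F E) ` feasible (sys x y) = feasible (sys y x)" (is "?f ` _ = _")
  proof -
    have sub: "?f X \<in> feasible (sys v u)" if "X \<in> feasible (sys u v)" for X u v
    proof -
      have "basis (\<lambda>e. if e \<in> sym_diff X E then u else v) = basis (\<lambda>e. if e \<in> X then v else u)"
        using that by (intro basis_cong) (auto simp: feasible_sys)
      then show ?thesis using that by (auto simp: feasible_sys)
    qed
    moreover have "?f (?f X) = X" if "X \<subseteq> E" for X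
      using that by auto
    ultimately show ?thesis
      by (metis (no_types, lifting) feasible_sys image_eqI image_subsetI subsetI subset_antisym)
  qed
  then show ?thesis
    by (simp add: dual_def twist_def sys_def)
qed

text \<open>Among the three values of an entry either none or exactly two give a basis. In terms of feasible sets
this is the rule for loop complementation.\<close>

lemma basis_third_iff:
  assumes T: "\<And>f. f \<in> E \<Longrightarrow> T f \<noteq> 0" and e: "e \<in> E" and xy: "x \<noteq> 0" "y \<noteq> 0" "x \<noteq> y"
  shows "basis (T(e := x + y)) \<longleftrightarrow> basis (T(e := x)) \<noteq> basis (T(e := y))"
proof -
  have z: "x + y \<noteq> 0" "x + y \<noteq> x" "x + y \<noteq> y"
    using bit_pair_third[OF xy, of "x + y"] by auto
  have key: "\<exists>u. u \<in> {x, y, x + y} \<and> (\<forall>q\<in>{x, y, x + y}. basis (T(e := q)) \<longleftrightarrow> q \<noteq> u)"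
    if p: "p \<in> {x, y, x + y}" "basis (T(e := p))" for p
  proof -
    have ne: "(T(e := p)) f \<noteq> 0" if "f \<in> E" for f
      using T that p z xy by auto
    obtain v where v: "v \<in> L" "v e \<noteq> 0" "v e \<noteq> (T(e := p)) e"
      "\<And>f. f \<in> E \<Longrightarrow> f \<noteq> e \<Longrightarrow> v f = 0 \<or> v f = (T(e := p)) f"
      using fundamental_vector[OF p(2) ne e] by blast
    have "basis (T(e := q)) \<longleftrightarrow> q \<noteq> v e" if "q \<noteq> 0" for q
      using basis_change_iff[OF p(2) v(1) e v(2,3) v(4) that] unfolding fun_upd_upd by simp
    moreover have "v e \<in> {x, y, x + y}"
      using bit_pair_third[OF xy, of "v e"] v(2) by auto
    ultimately show ?thesis
      using z xy by (intro exI[of _ "v e"]) auto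
  qed
  show ?thesis
    using key[of x] key[of y] key[of "x + y"] z xy by auto
qed

end

lemma even_card_sym_diff:
  assumes "finite A" "finite B"
  shows "even (card (sym_diff A B)) \<longleftrightarrow> (even (card A) \<longleftrightarrow> even (card B))"
proof -
  have "card A = card (A - B) + card (A \<inter> B)" "card B = card (B - A) + card (A \<inter> B)"
    "card (sym_diff A B) = card (A - B) + card (B - A)"
    using assms card_Int_Diff[of A B] card_Int_Diff[of B A] card_Un_disjoint[of "A - B" "B - A"]
    by (auto simp: Int_commute)
  then show ?thesis by auto
qed

lemma bit_pair_sum_off_line:
  fixes a b z :: "bit \<times> bit"
  assumes "z \<noteq> 0" "(a = 0 \<or> a = z) \<longleftrightarrow> (b = 0 \<or> b = z)"
  shows "a + b = 0 \<or> a + b = z"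
  using assms
  by (cases a rule: bit_pair_cases; cases b rule: bit_pair_cases; cases z rule: bit_pair_cases)
    (auto simp: zero_prod_def)

lemma bit_pair_sum_on_line:
  fixes a b z :: "bit \<times> bit"
  assumes "b = 0 \<or> b = z"
  shows "(a + b = 0 \<or> a + b = z) \<longleftrightarrow> (a = 0 \<or> a = z)"
  using assms
  by (cases a rule: bit_pair_cases; cases b rule: bit_pair_cases; cases z rule: bit_pair_cases)
    (auto simp: zero_prod_def)

context lagrangian
begin

text \<open>If \<open>u\<close> alone cannot be exchanged, the fundamental vector at \<open>u\<close> has the entry of \<open>Y\<close> there. As \<open>Y\<close>
is a basis, that vector leaves \<open>Y\<close> in some coordinate \<open>w\<close>, and there it agrees with \<open>X\<close>, so
\<open>basis_exchange\<close> applies to \<open>u\<close> and \<open>w\<close>.\<close>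

lemma sys_exchange:
  assumes xy: "x \<noteq> 0" "y \<noteq> 0" "x \<noteq> y"
    and X: "X \<in> feasible (sys x y)" and Y: "Y \<in> feasible (sys x y)" and u: "u \<in> sym_diff X Y"
  shows "\<exists>w\<in>sym_diff X Y. sym_diff X {u, w} \<in> feasible (sys x y)"
proof (cases "sym_diff X {u} \<in> feasible (sys x y)")
  case True
  then show ?thesis using u by (intro bexI[of _ u]) auto
next
  case False
  define T where "T X = (\<lambda>e. if e \<in> X then y else x)" for X :: "'a set"
  have uE: "u \<in> E" using X Y u by (auto simp: feasible_sys)
  have bX: "basis (T X)" and bY: "basis (T Y)" using X Y by (auto simp: feasible_sys T_def)
  have T0: "T X e \<noteq> 0" for X e using xy by (auto simp: T_def)
  obtain v where v: "v \<in> L" "v u \<noteq> 0" "v u \<noteq> T X u"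
    "\<And>f. f \<in> E \<Longrightarrow> f \<noteq> u \<Longrightarrow> v f = 0 \<or> v f = T X f"
    using fundamental_vector[OF bX T0 uE] by blast
  have "\<not> basis (T (sym_diff X {u}))"
    using False X uE by (auto simp: feasible_sys T_def)
  moreover have "T (sym_diff X {u}) = (T X)(u := T Y u)"
    using u by (auto simp: T_def fun_eq_iff)
  ultimately have vu: "v u = T Y u"
    using basis_change_iff[OF bX v(1) uE v(2-4) T0] by auto
  obtain w where w: "w \<in> E" "v w \<noteq> 0" "v w \<noteq> T Y w"
    using bY v(1,2) unfolding basis_def supported_def by fastforce
  have wu: "w \<noteq> u" using w vu by auto
  then have "T X w \<noteq> T Y w" using v(4)[OF w(1)] w by auto
  then have wd: "w \<in> sym_diff X Y" by (auto simp: T_def split: if_splits)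
  have "basis ((T X)(u := v u, w := T Y w))"
    using basis_exchange[OF bX v(1) uE v(2-4) w(1) wu w(2)] \<open>T X w \<noteq> T Y w\<close> by auto
  also have "(T X)(u := v u, w := T Y w) = T (sym_diff X {u, w})"
    unfolding vu using u wd wu by (auto simp: T_def fun_eq_iff)
  finally show ?thesis
    using wd X uE w(1) by (intro bexI[of _ w]) (auto simp: feasible_sys T_def)
qed

definition count :: "bit \<times> bit \<Rightarrow> ('a \<Rightarrow> bit \<times> bit) \<Rightarrow> bit" where
  "count z v = (\<Sum>e\<in>E. of_bool (v e = z))"

lemma count_add:
  assumes "z \<noteq> 0" "v \<in> L" "w \<in> L"
  shows "count z (\<lambda>e. v e + w e) = count z v + count z w"
proof -
  have "count z (\<lambda>e. v e + w e) = count z v + count z w + (\<Sum>e\<in>E. sform (v e) (w e))"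
    by (simp only: count_def of_bool_add_eq_sform[OF assms(1)] sum.distrib)
  then show ?thesis
    using isotropic[OF assms(2,3)] by simp
qed

text \<open>Fix a feasible set and its basis \<open>T\<close>. Evenness forbids to exchange a single element, so by tightness
no fundamental vector has an entry \<open>x + y\<close>. The fundamental vectors generate \<open>L\<close>: the induction
removes, by adding one of them, a coordinate in which \<open>v\<close> leaves the lines of \<open>T\<close>.\<close>

lemma even_sys_imp_count:
  assumes xy: "x \<noteq> 0" "y \<noteq> 0" "x \<noteq> y" and ev: "even_system (sys x y)" and "v \<in> L"
  shows "count (x + y) v = 0"
proof -
  have z: "x + y \<noteq> 0" "x + y \<noteq> x" "x + y \<noteq> y"
    using bit_pair_third[OF xy, of "x + y"] by auto
  obtain X where X: "X \<in> feasible (sys x y)"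
    using feasible_sys_nonempty[OF xy] by blast
  define T where "T = (\<lambda>e. if e \<in> X then y else x)"
  have bT: "basis T" and T0: "\<And>e. T e \<noteq> 0"
    using X xy by (auto simp: feasible_sys T_def)
  define off where "off v = {e \<in> E. v e \<noteq> 0 \<and> v e \<noteq> T e}" for v
  have fin: "finite (off v)" for v using finite_E by (simp add: off_def)
  have count_0: "count (x + y) v = 0" if "\<forall>e\<in>E. v e = 0 \<or> v e = x \<or> v e = y" for v
    unfolding count_def using that z by (intro sum.neutral) auto
  show ?thesis
    using \<open>v \<in> L\<close>
  proof (induction "card (off v)" arbitrary: v rule: less_induct)
    case less
    show ?case
    proof (cases "off v = {}")
      case True
      then have "supported v T" by (auto simp: supported_def off_def)
      then have "v = (\<lambda>_. 0)" using bT less(2) by (simp add: basis_def)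
      then show ?thesis using count_0 by simp
    next
      case False
      then obtain e where e: "e \<in> off v" by blast
      then have eE: "e \<in> E" by (simp add: off_def)
      obtain u where u: "u \<in> L" "u e \<noteq> 0" "u e \<noteq> T e"
        "\<And>f. f \<in> E \<Longrightarrow> f \<noteq> e \<Longrightarrow> u f = 0 \<or> u f = T f"
        using fundamental_vector[OF bT T0 eE] by blast
      have "sym_diff X {e} \<notin> feasible (sys x y)"
      proof
        assume "sym_diff X {e} \<in> feasible (sys x y)"
        then have "even (card X) \<longleftrightarrow> even (card (sym_diff X {e}))"
          using ev X unfolding even_system_def by blast
        moreover have "finite X" using X finite_E finite_subset by (auto simp: feasible_sys)
        ultimately show False using even_card_sym_diff[of X "{e}"] by auto
      qed
      then have "\<not> basis (\<lambda>f. if f \<in> sym_diff X {e} then y else x)"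
        using X eE by (auto simp: feasible_sys)
      moreover have "(\<lambda>f. if f \<in> sym_diff X {e} then y else x) = T(e := if e \<in> X then x else y)"
        by (auto simp: T_def fun_eq_iff)
      ultimately have ue: "u e = (if e \<in> X then x else y)"
        using basis_change_iff[OF bT u(1) eE u(2-4), of "if e \<in> X then x else y"] xy by auto
      have "count (x + y) u = 0"
      proof (rule count_0, rule ballI)
        fix f assume "f \<in> E"
        then show "u f = 0 \<or> u f = x \<or> u f = y"
          using ue u(4)[of f] by (cases "f = e") (auto simp: T_def)
      qed
      moreover have "off (\<lambda>e. v e + u e) \<subset> off v"
      proof
        show "off (\<lambda>e. v e + u e) \<subseteq> off v"
        proof
          fix f assume f: "f \<in> off (\<lambda>e. v e + u e)"
          then have "f \<noteq> e"
            using bit_pair_sum_off_line[OF T0, of "v e" e "u e"] e u(2,3) by (auto simp: off_def)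
          then show "f \<in> off v"
            using f u(4)[of f] bit_pair_sum_on_line[of "u f" "T f" "v f"] by (auto simp: off_def)
        qed
        show "off (\<lambda>e. v e + u e) \<noteq> off v"
          using bit_pair_sum_off_line[OF T0, of "v e" e "u e"] e u(2,3) by (auto simp: off_def)
      qed
      then have "count (x + y) (\<lambda>e. v e + u e) = 0"
        using less(2) u(1) by (intro less(1) psubset_card_mono fin add_mem)
      ultimately show ?thesis
        using count_add[OF z(1) less(2) u(1)] by simp
    qed
  qed
qed

text \<open>Two feasible sets that differ in one element would produce a fundamental vector with exactly one entry
\<open>x + y\<close>. So every exchange step changes two elements and keeps the parity, and exchange steps lead
from \<open>X\<close> to \<open>Y\<close>.\<close>

lemma count_imp_even_sys:
  assumes xy: "x \<noteq> 0" "y \<noteq> 0" "x \<noteq> y" and zero: "\<And>v. v \<in> L \<Longrightarrow> count (x + y) v = 0"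
  shows "even_system (sys x y)"
proof -
  have z: "x + y \<noteq> 0" "x + y \<noteq> x" "x + y \<noteq> y"
    using bit_pair_third[OF xy, of "x + y"] by auto
  define T where "T X = (\<lambda>e. if e \<in> X then y else x)" for X :: "'a set"
  have T0: "T X e \<noteq> 0" for X e using xy by (auto simp: T_def)
  have no_single: False
    if X: "X \<in> feasible (sys x y)" and X': "sym_diff X {u} \<in> feasible (sys x y)" and u: "u \<in> E" for X u
  proof -
    have bX: "basis (T X)" and bX': "basis (T (sym_diff X {u}))"
      using X X' by (auto simp: feasible_sys T_def)
    obtain v where v: "v \<in> L" "v u \<noteq> 0" "v u \<noteq> T X u"
      "\<And>f. f \<in> E \<Longrightarrow> f \<noteq> u \<Longrightarrow> v f = 0 \<or> v f = T X f"
      using fundamental_vector[OF bX T0 u] by blast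
    have eq: "T (sym_diff X {u}) = (T X)(u := T (sym_diff X {u}) u)"
      by (auto simp: T_def fun_eq_iff)
    have "v u \<noteq> T (sym_diff X {u}) u"
      using basis_change_iff[OF bX v(1) u v(2-4) T0, of "sym_diff X {u}" u] bX' eq by metis
    then have vu: "v u = x + y"
      using v(2,3) bit_pair_third[OF xy, of "v u"] by (auto simp: T_def split: if_splits)
    have "(\<Sum>e\<in>E. of_bool (v e = x + y) :: bit)
      = of_bool (v u = x + y) + (\<Sum>e\<in>E - {u}. of_bool (v e = x + y))"
      using finite_E u by (rule sum.remove)
    also have "(\<Sum>e\<in>E - {u}. of_bool (v e = x + y) :: bit) = 0"
    proof (rule sum.neutral, rule ballI)
      fix f assume "f \<in> E - {u}"
      then have "v f = 0 \<or> v f = x \<or> v f = y" using v(4)[of f] by (auto simp: T_def)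
      then show "(of_bool (v f = x + y) :: bit) = 0" using z by auto
    qed
    finally show False using zero[OF v(1)] vu by (simp add: count_def)
  qed
  have "even (card X) \<longleftrightarrow> even (card Y)"
    if "X \<in> feasible (sys x y)" "Y \<in> feasible (sys x y)" for X Y
    using that
  proof (induction "card (sym_diff X Y)" arbitrary: X rule: less_induct)
    case less
    show ?case
    proof (cases "sym_diff X Y = {}")
      case True
      then have "X = Y" by blast
      then show ?thesis by simp
    next
      case False
      then obtain u where u: "u \<in> sym_diff X Y" by blast
      obtain w where w: "w \<in> sym_diff X Y" "sym_diff X {u, w} \<in> feasible (sys x y)"
        using sys_exchange[OF xy less(2,3) u] by blast
      have sub: "X \<subseteq> E" "Y \<subseteq> E" using less(2,3) by (auto simp: feasible_sys)
      then have fin: "finite X" "finite Y" using finite_E finite_subset by auto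
      have wu: "w \<noteq> u"
        using no_single[OF less(2), of u] w u sub by auto
      have "sym_diff (sym_diff X {u, w}) Y \<subset> sym_diff X Y"
        using u w(1) by blast
      then have "card (sym_diff (sym_diff X {u, w}) Y) < card (sym_diff X Y)"
        using fin by (intro psubset_card_mono) auto
      then have "even (card (sym_diff X {u, w})) \<longleftrightarrow> even (card Y)"
        using less(1) w(2) less(3) by blast
      moreover have "even (card (sym_diff X {u, w})) \<longleftrightarrow> even (card X)"
        using even_card_sym_diff[OF fin(1), of "{u, w}"] wu by auto
      ultimately show ?thesis by simp
    qed
  qed
  then show ?thesis unfolding even_system_def by blast
qed

theorem even_sys_iff:
  assumes "x \<noteq> 0" "y \<noteq> 0" "x \<noteq> y"
  shows "even_system (sys x y) \<longleftrightarrow> (\<forall>v\<in>L. count (x + y) v = 0)"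
  using even_sys_imp_count[OF assms] count_imp_even_sys[OF assms] by blast

end

section \<open>Loop complementation\<close>

lemma mem_feasible_loop_compl1:
  "Y \<in> feasible (loop_compl1 e D) \<longleftrightarrow> (Y \<in> feasible D) \<noteq> (e \<in> Y \<and> Y - {e} \<in> feasible D)"
proof -
  have "Y \<in> {F \<union> {e} |F. F \<in> feasible D \<and> e \<notin> F} \<longleftrightarrow> e \<in> Y \<and> Y - {e} \<in> feasible D"
  proof
    assume "e \<in> Y \<and> Y - {e} \<in> feasible D"
    then show "Y \<in> {F \<union> {e} |F. F \<in> feasible D \<and> e \<notin> F}"
      by (intro CollectI exI[of _ "Y - {e}"]) auto
  qed auto
  moreover have "feasible (loop_compl1 e D) =
      sym_diff (feasible D) {F \<union> {e} |F. F \<in> feasible D \<and> e \<notin> F}"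
    by (simp add: loop_compl1_def)
  ultimately show ?thesis
    by blast
qed

lemma ground_loop_compl1 [simp]: "ground (loop_compl1 e D) = ground D"
  by (simp add: loop_compl1_def)

lemma set_system_eqI:
  fixes D D' :: "'a set_system"
  shows "ground D = ground D' \<Longrightarrow> (\<And>X. X \<in> feasible D \<longleftrightarrow> X \<in> feasible D') \<Longrightarrow> D = D'"
  by (cases D; cases D') auto

interpretation loop_compl1: comp_fun_commute loop_compl1
proof
  fix e f :: 'a
  show "loop_compl1 f \<circ> loop_compl1 e = loop_compl1 e \<circ> loop_compl1 f"
  proof
    fix D :: "'a set_system"
    have "Y - {e} - {f} = Y - {f} - {e}" for Y by auto
    then show "(loop_compl1 f \<circ> loop_compl1 e) D = (loop_compl1 e \<circ> loop_compl1 f) D"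
      by (intro set_system_eqI) (auto simp: mem_feasible_loop_compl1)
  qed
qed

context lagrangian
begin

text \<open>Loop complementation at \<open>a\<close> replaces the alternative \<open>y\<close> by \<open>x + y\<close> in the coordinate \<open>a\<close> alone,
because the feasibility of a set containing \<open>a\<close> is added modulo 2 to that of the set
without \<open>a\<close>, as in \<open>basis_third_iff\<close>.\<close>

lemma feasible_loop_compl_sys:
  assumes xy: "x \<noteq> 0" "y \<noteq> 0" "x \<noteq> y" and "F \<subseteq> E"
  shows "loop_compl (sys x y) F = \<lparr>ground = E, feasible =
    {Y. Y \<subseteq> E \<and> basis (\<lambda>e. if e \<in> Y then if e \<in> F then x + y else y else x)}\<rparr>"
  using finite_subset[OF \<open>F \<subseteq> E\<close> finite_E] \<open>F \<subseteq> E\<close>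
proof (induction F rule: finite_induct)
  case empty
  show ?case by (simp add: loop_compl_def sys_def cong: if_cong)
next
  case (insert a F)
  have z: "x + y \<noteq> 0"
    using bit_pair_third[OF xy, of "x + y"] by auto
  define T where "T F Y = (\<lambda>e. if e \<in> Y then if e \<in> F then x + y else y else x)" for F Y :: "'a set"
  have a: "a \<in> E" using insert by simp
  have IH: "loop_compl (sys x y) F = \<lparr>ground = E, feasible = {Y. Y \<subseteq> E \<and> basis (T F Y)}\<rparr>"
    using insert by (simp add: T_def)
  have "loop_compl (sys x y) (insert a F) = loop_compl1 a (loop_compl (sys x y) F)"
    using insert by (simp add: loop_compl_def)
  also have "\<dots> = \<lparr>ground = E, feasible = {Y. Y \<subseteq> E \<and> basis (T (insert a F) Y)}\<rparr>"
  proof (rule set_system_eqI)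
    fix Y
    have "basis (T (insert a F) Y) \<longleftrightarrow> basis (T F Y) \<noteq> basis (T F (Y - {a}))" if "a \<in> Y"
    proof -
      have "T (insert a F) Y = (T F Y)(a := x + y)" "T F Y = (T F Y)(a := y)"
        "T F (Y - {a}) = (T F Y)(a := x)"
        using that insert by (auto simp: T_def fun_eq_iff)
      moreover have "T F Y f \<noteq> 0" for f using xy z by (simp add: T_def)
      ultimately show ?thesis
        using basis_third_iff[OF _ a xy, of "T F Y"] by metis
    qed
    moreover have "T (insert a F) Y = T F Y" if "a \<notin> Y"
      using that by (auto simp: T_def fun_eq_iff)
    ultimately show "Y \<in> feasible (loop_compl1 a (loop_compl (sys x y) F)) \<longleftrightarrow>
        Y \<in> feasible \<lparr>ground = E, feasible = {Y. Y \<subseteq> E \<and> basis (T (insert a F) Y)}\<rparr>"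
      using a unfolding mem_feasible_loop_compl1 IH by (cases "a \<in> Y") auto
  qed (simp add: IH)
  finally show ?case by (simp add: T_def)
qed

theorem plus_all_sys:
  assumes "x \<noteq> 0" "y \<noteq> 0" "x \<noteq> y"
  shows "plus_all (sys x y) = sys x (x + y)"
proof -
  have "basis (\<lambda>e. if e \<in> Y then if e \<in> E then x + y else y else x)
      = basis (\<lambda>e. if e \<in> Y then x + y else x)" for Y
    by (intro basis_cong) auto
  then show ?thesis
    using feasible_loop_compl_sys[OF assms order_refl] by (simp add: plus_all_def) (simp add: sys_def)
qed

end

section \<open>Minimal members of a family of sets\<close>

definition min_members :: "'a set set \<Rightarrow> 'a set set" where
  "min_members \<C> = {C \<in> \<C>. C \<noteq> {} \<and> (\<forall>C'\<in>\<C>. C' \<noteq> {} \<and> C' \<subseteq> C \<longrightarrow> C' = C)}"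

text \<open>Closure under relative differences makes every member a disjoint union of minimal nonempty members.
This covers both the cycle space of a binary matroid and the supports of the vectors of \<open>L\<close>,
which are not closed under symmetric difference.\<close>

lemma weight_zero_if_zero_on_min_members:
  fixes w :: "'a \<Rightarrow> bit"
  assumes fin: "\<And>C. C \<in> \<C> \<Longrightarrow> finite C"
    and diff: "\<And>C C'. C \<in> \<C> \<Longrightarrow> C' \<in> \<C> \<Longrightarrow> C' \<subseteq> C \<Longrightarrow> C - C' \<in> \<C>"
    and zero: "\<And>C. C \<in> min_members \<C> \<Longrightarrow> sum w C = 0"
    and "C \<in> \<C>"
  shows "sum w C = 0"
  using fin[OF \<open>C \<in> \<C>\<close>] \<open>C \<in> \<C>\<close>
proof (induction C rule: finite_psubset_induct)
  case (psubset C)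
  show ?case
  proof (cases "C = {} \<or> C \<in> min_members \<C>")
    case True
    then show ?thesis using zero by auto
  next
    case False
    then obtain C' where C': "C' \<in> \<C>" "C' \<noteq> {}" "C' \<subset> C"
      using psubset.prems by (auto simp: min_members_def)
    have "sum w C = sum w (C - C') + sum w C'"
      using C'(3) psubset.hyps by (intro sum.subset_diff) auto
    also have "\<dots> = 0"
      using psubset.IH[of C'] psubset.IH[of "C - C'"] C' diff[OF psubset.prems C'(1)] by auto
    finally show ?thesis .
  qed
qed

section \<open>Bipartiteness\<close>

context lagrangian
begin

text \<open>The support of \<open>v\<close> after dividing every plane by the line through \<open>x\<close>. Over all \<open>v\<close> in \<open>L\<close>
these sets form the cycle space of the lower matroid of \<open>sys x y\<close>.\<close>

definition off_line :: "bit \<times> bit \<Rightarrow> ('a \<Rightarrow> bit \<times> bit) \<Rightarrow> 'a set" where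
  "off_line x v = {e \<in> E. v e \<noteq> 0 \<and> v e \<noteq> x}"

lemma off_line_add:
  assumes "x \<noteq> 0"
  shows "off_line x (\<lambda>e. v e + w e) = sym_diff (off_line x v) (off_line x w)"
proof -
  have "e \<in> off_line x (\<lambda>e. v e + w e) \<longleftrightarrow> e \<in> sym_diff (off_line x v) (off_line x w)" for e
    using bit_pair_sum_off_line[OF assms, of "v e" "w e"] bit_pair_sum_on_line[of "w e" x "v e"]
      bit_pair_sum_on_line[of "v e" x "w e"] by (auto simp: off_line_def add.commute)
  then show ?thesis by blast
qed

text \<open>By minimality of \<open>B\<close> neither one nor two of its elements can be removed. This forces
the fundamental vector \<open>c\<close> at \<open>u\<close> to be \<open>x\<close> in \<open>u\<close> and zero on the rest of \<open>B\<close>: a cocircuit that meets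
the cycle of \<open>v\<close> in the single element \<open>u\<close>, against isotropy.\<close>

lemma min_feasible_imp_no_cycle:
  assumes xy: "x \<noteq> 0" "y \<noteq> 0" "x \<noteq> y" and B: "B \<in> min_feasible (sys x y)"
    and v: "v \<in> L" "off_line x v \<subseteq> B"
  shows "off_line x v = {}"
proof (rule ccontr)
  assume "off_line x v \<noteq> {}"
  then obtain u where u: "u \<in> E" "v u \<noteq> 0" "v u \<noteq> x" "u \<in> B"
    using v(2) by (auto simp: off_line_def)
  define T where "T X = (\<lambda>e. if e \<in> X then y else x)" for X :: "'a set"
  have T0: "T X e \<noteq> 0" for X e using xy by (auto simp: T_def)
  have BE: "B \<subseteq> E" and bB: "basis (T B)" and minB: "\<And>F. F \<subseteq> E \<Longrightarrow> basis (T F) \<Longrightarrow> card B \<le> card F"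
    using B by (auto simp: min_feasible_def feasible_sys T_def)
  have finB: "finite B" using BE finite_E finite_subset by blast
  have small: "\<not> basis (T F)" if "F \<subset> B" for F
    using minB[of F] psubset_card_mono[OF finB that] BE that by auto
  obtain c where c: "c \<in> L" "c u \<noteq> 0" "c u \<noteq> T B u"
    "\<And>f. f \<in> E \<Longrightarrow> f \<noteq> u \<Longrightarrow> c f = 0 \<or> c f = T B f"
    using fundamental_vector[OF bB T0 u(1)] by blast
  have "T (B - {u}) = (T B)(u := x)"
    using u by (auto simp: T_def fun_eq_iff)
  then have cu: "c u = x"
    using basis_change_iff[OF bB c(1) u(1) c(2-4), of x] xy small[of "B - {u}"] u by auto
  have c_zero: "c w = 0" if w: "w \<in> B" "w \<noteq> u" for w
  proof (rule ccontr)
    assume "c w \<noteq> 0"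
    moreover have "x \<noteq> T B w" "w \<in> E" using w xy BE by (auto simp: T_def)
    ultimately have "basis ((T B)(u := c u, w := x))"
      using basis_exchange[OF bB c(1) u(1) c(2-4)] w by blast
    also have "(T B)(u := c u, w := x) = T (B - {u, w})"
      using cu w u by (auto simp: T_def fun_eq_iff)
    finally show False using small[of "B - {u, w}"] w by auto
  qed
  have "v u = 0 \<or> c u = 0 \<or> v u = c u"
  proof (rule isotropic_at[OF v(1) c(1) u(1)])
    fix f assume f: "f \<in> E" "f \<noteq> u"
    show "v f = 0 \<or> c f = 0 \<or> v f = c f"
    proof (cases "f \<in> B")
      case False
      then have "v f = 0 \<or> v f = x" using v(2) f by (auto simp: off_line_def)
      then show ?thesis using c(4)[OF f] False by (auto simp: T_def)
    qed (use c_zero f in auto)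
  qed
  then show False using u cu xy by auto
qed

text \<open>Choose \<open>B\<close> of minimum size that contains as much of \<open>I\<close> as possible. For an element \<open>u\<close> of \<open>I\<close>
outside \<open>B\<close>, the fundamental vector at \<open>u\<close> yields a cycle through \<open>u\<close>, which by hypothesis uses
some \<open>w\<close> outside \<open>I\<close>; exchanging \<open>w\<close> for \<open>u\<close> contradicts the choice of \<open>B\<close>.\<close>

lemma no_cycle_imp_min_feasible:
  assumes xy: "x \<noteq> 0" "y \<noteq> 0" "x \<noteq> y" and I: "I \<subseteq> E"
    and free: "\<And>v. v \<in> L \<Longrightarrow> off_line x v \<subseteq> I \<Longrightarrow> off_line x v = {}"
  shows "\<exists>B\<in>min_feasible (sys x y). I \<subseteq> B"
proof -
  define T where "T X = (\<lambda>e. if e \<in> X then y else x)" for X :: "'a set"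
  have T0: "T X e \<noteq> 0" for X e using xy by (auto simp: T_def)
  obtain B0 where B0: "B0 \<in> feasible (sys x y)" "\<And>F. F \<in> feasible (sys x y) \<Longrightarrow> card B0 \<le> card F"
    using feasible_sys_nonempty[OF xy] exists_least_iff[of "\<lambda>n. \<exists>F\<in>feasible (sys x y). card F = n"]
    by (metis all_not_in_conv not_le_imp_less)
  then have "B0 \<in> min_feasible (sys x y)" by (auto simp: min_feasible_def)
  moreover have fin: "finite (min_feasible (sys x y))"
    using finite_E by (auto simp: min_feasible_def sys_def)
  ultimately have "Max ((\<lambda>B. card (B \<inter> I)) ` min_feasible (sys x y))
      \<in> (\<lambda>B. card (B \<inter> I)) ` min_feasible (sys x y)"
    by (intro Max_in) auto
  then obtain B where B: "B \<in> min_feasible (sys x y)"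
    and Max_B: "Max ((\<lambda>B. card (B \<inter> I)) ` min_feasible (sys x y)) = card (B \<inter> I)"
    by (rule imageE)
  have maxB: "card (B' \<inter> I) \<le> card (B \<inter> I)" if "B' \<in> min_feasible (sys x y)" for B'
    unfolding Max_B[symmetric] using fin that by (intro Max_ge) auto
  have BE: "B \<subseteq> E" and bB: "basis (T B)" and minB: "\<And>F. F \<subseteq> E \<Longrightarrow> basis (T F) \<Longrightarrow> card B \<le> card F"
    using B by (auto simp: min_feasible_def feasible_sys T_def)
  have finB: "finite B" using BE finite_E finite_subset by blast
  have "I \<subseteq> B"
  proof (rule ccontr)
    assume "\<not> I \<subseteq> B"
    then obtain u where u: "u \<in> I" "u \<notin> B" "u \<in> E" using I by auto
    obtain v where v: "v \<in> L" "v u \<noteq> 0" "v u \<noteq> T B u"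
      "\<And>f. f \<in> E \<Longrightarrow> f \<noteq> u \<Longrightarrow> v f = 0 \<or> v f = T B f"
      using fundamental_vector[OF bB T0 u(3)] by blast
    have "u \<in> off_line x v" using u v(2,3) by (auto simp: off_line_def T_def)
    then have "\<not> off_line x v \<subseteq> I" using free[OF v(1)] by auto
    then obtain w where w: "w \<in> E" "v w \<noteq> 0" "v w \<noteq> x" "w \<notin> I"
      by (auto simp: off_line_def)
    then have wu: "w \<noteq> u" using u by auto
    have wB: "w \<in> B" using v(4)[OF w(1) wu] w by (auto simp: T_def split: if_splits)
    have b1: "basis ((T B)(u := v u, w := x))"
      using basis_exchange[OF bB v(1) u(3) v(2-4) w(1) wu w(2), of x] wB xy by (auto simp: T_def)
    define S where "S = (T B)(w := x)"
    have S: "S = T (B - {w})" "S(u := v u) = (T B)(u := v u, w := x)" "S(u := x) = S"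
      "S(u := y) = T (insert u (B - {w}))"
      using wu u wB by (auto simp: S_def T_def fun_eq_iff)
    \<comment> \<open>\<open>T B\<close> with the entries \<open>x\<close> at \<open>w\<close> is the smaller set \<open>B - {w}\<close>, so it is not a basis. Among the
      values at \<open>u\<close> the entry \<open>x\<close> is thus the only one that fails, whichever of \<open>y\<close> and \<open>x + y\<close> the
      fundamental vector has there.\<close>
    have "\<not> basis S"
      using minB[of "B - {w}"] BE wB finB S(1) card_Diff1_less[of B w] by auto
    moreover have "v u = y \<or> v u = x + y"
      using bit_pair_third[OF xy, of "v u"] v(2,3) u by (auto simp: T_def)
    moreover have "basis (S(u := v u))" using b1 S(2) by simp
    moreover have "S e \<noteq> 0" for e using S(1) T0 by simp
    ultimately have "basis (S(u := y))"
      using basis_third_iff[OF _ u(3) xy, of S] S(3) by auto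
    then have "basis (T (insert u (B - {w})))" using S(4) by simp
    moreover have "card (insert u (B - {w})) = card B"
      using u wB finB using card_Suc_Diff1[OF finB wB] by simp
    ultimately have "insert u (B - {w}) \<in> min_feasible (sys x y)"
      using B BE u(3) by (auto simp: min_feasible_def feasible_sys T_def)
    then have "card (insert u (B - {w}) \<inter> I) \<le> card (B \<inter> I)" by (rule maxB)
    moreover have "insert u (B - {w}) \<inter> I = insert u (B \<inter> I)" using u w by auto
    ultimately show False using u finB by simp
  qed
  then show ?thesis using B by blast
qed

lemma circuits_D_min_sys:
  assumes xy: "x \<noteq> 0" "y \<noteq> 0" "x \<noteq> y"
  shows "matroid_circuits (D_min (sys x y)) = min_members (off_line x ` L)"
proof -
  have ind: "(\<exists>B\<in>min_feasible (sys x y). I \<subseteq> B) \<longleftrightarrow> (\<forall>C\<in>off_line x ` L. C \<subseteq> I \<longrightarrow> C = {})"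
    if "I \<subseteq> E" for I
    using min_feasible_imp_no_cycle[OF xy] no_cycle_imp_min_feasible[OF xy that]
    by (smt (verit) image_iff order_trans)
  have sub: "C \<in> off_line x ` L \<Longrightarrow> C \<subseteq> E" for C
    by (auto simp: off_line_def)
  show ?thesis
  proof (intro set_eqI iffI)
    fix C assume "C \<in> matroid_circuits (D_min (sys x y))"
    then have C: "C \<subseteq> E" "\<not> (\<exists>B\<in>min_feasible (sys x y). C \<subseteq> B)"
      "\<And>C'. C' \<subset> C \<Longrightarrow> \<exists>B\<in>min_feasible (sys x y). C' \<subseteq> B"
      by (auto simp: matroid_circuits_def D_min_def)
    obtain C' where C': "C' \<in> off_line x ` L" "C' \<subseteq> C" "C' \<noteq> {}"
      using C(2) ind[OF C(1)] by blast
    have minimal: "C'' = C" if "C'' \<in> off_line x ` L" "C'' \<subseteq> C" "C'' \<noteq> {}" for C''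
      using that C(3)[of C''] ind[of C''] sub by blast
    show "C \<in> min_members (off_line x ` L)"
      using C' minimal by (auto simp: min_members_def)
  next
    fix C assume C: "C \<in> min_members (off_line x ` L)"
    then have "C \<subseteq> E" using sub by (simp add: min_members_def)
    moreover have "\<not> (\<exists>B\<in>min_feasible (sys x y). C \<subseteq> B)"
      using ind[OF \<open>C \<subseteq> E\<close>] C by (auto simp: min_members_def)
    moreover have "\<exists>B\<in>min_feasible (sys x y). C' \<subseteq> B" if "C' \<subset> C" for C'
    proof -
      have "\<forall>D\<in>off_line x ` L. D \<noteq> {} \<and> D \<subseteq> C \<longrightarrow> D = C"
        using C by (simp add: min_members_def)
      then have "\<forall>D\<in>off_line x ` L. D \<subseteq> C' \<longrightarrow> D = {}"
        using that by blast
      then show ?thesis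
        using ind[of C'] that \<open>C \<subseteq> E\<close> by simp
    qed
    ultimately show "C \<in> matroid_circuits (D_min (sys x y))"
      by (auto simp: matroid_circuits_def D_min_def)
  qed
qed

theorem bipartite_sys_iff:
  assumes xy: "x \<noteq> 0" "y \<noteq> 0" "x \<noteq> y"
  shows "bipartite (sys x y) \<longleftrightarrow> (\<forall>v\<in>L. count y v + count (x + y) v = 0)"
proof -
  have z: "x + y \<noteq> 0" "x + y \<noteq> x" "x + y \<noteq> y"
    using bit_pair_third[OF xy, of "x + y"] by auto
  have fin: "finite (off_line x v)" for v
    using finite_E by (simp add: off_line_def)
  have even_iff: "even (card C) \<longleftrightarrow> (\<Sum>e\<in>C. 1 :: bit) = 0" for C :: "'a set"
    by (simp add: of_nat_bit_eq)
  have wt: "(\<Sum>e\<in>off_line x v. 1 :: bit) = count y v + count (x + y) v" for v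
  proof -
    have "(of_bool (v e = y) + of_bool (v e = x + y) :: bit) = of_bool (v e \<noteq> 0 \<and> v e \<noteq> x)" for e
      using bit_pair_third[OF xy, of "v e"] z xy by auto
    then have "count y v + count (x + y) v = (\<Sum>e\<in>E. of_bool (v e \<noteq> 0 \<and> v e \<noteq> x))"
      by (simp only: count_def sum.distrib[symmetric])
    also have "\<dots> = (\<Sum>e\<in>E. if v e \<noteq> 0 \<and> v e \<noteq> x then 1 else 0)"
      by (simp only: of_bool_def)
    also have "\<dots> = (\<Sum>e\<in>off_line x v. 1)"
      unfolding off_line_def by (rule sum.inter_filter[OF finite_E, symmetric])
    finally show ?thesis by simp
  qed
  have "bipartite (sys x y) \<longleftrightarrow> (\<forall>C\<in>min_members (off_line x ` L). (\<Sum>e\<in>C. 1 :: bit) = 0)"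
    unfolding bipartite_def circuits_D_min_sys[OF xy] even_iff ..
  also have "\<dots> \<longleftrightarrow> (\<forall>C\<in>off_line x ` L. (\<Sum>e\<in>C. 1 :: bit) = 0)"
  proof
    assume zero: "\<forall>C\<in>min_members (off_line x ` L). (\<Sum>e\<in>C. 1 :: bit) = 0"
    show "\<forall>C\<in>off_line x ` L. (\<Sum>e\<in>C. 1 :: bit) = 0"
    proof
      fix C assume "C \<in> off_line x ` L"
      then show "(\<Sum>e\<in>C. 1 :: bit) = 0"
      proof (rule weight_zero_if_zero_on_min_members[rotated 3])
        fix C C' assume "C \<in> off_line x ` L" "C' \<in> off_line x ` L" and sub: "C' \<subseteq> C"
        then obtain v w where vw: "v \<in> L" "w \<in> L" "C = off_line x v" "C' = off_line x w" by blast
        then have "off_line x (\<lambda>e. v e + w e) = C - C'"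
          using off_line_add[OF xy(1), of v w] sub by blast
        then show "C - C' \<in> off_line x ` L"
          using add_mem[OF vw(1,2)] by blast
      qed (use fin zero in auto)
    qed
  qed (auto simp: min_members_def)
  also have "\<dots> \<longleftrightarrow> (\<forall>v\<in>L. count y v + count (x + y) v = 0)"
    unfolding wt[symmetric] by blast
  finally show ?thesis .
qed

end

section \<open>Binary delta-matroids come from Lagrangian subspaces\<close>

lemma sum_mult_bit:
  fixes g y :: "'a \<Rightarrow> bit"
  assumes "finite S"
  shows "(\<Sum>k\<in>S. g k * y k) = sum g {k \<in> S. y k = 1}"
proof -
  have "(\<Sum>k\<in>S. g k * y k) = (\<Sum>k\<in>S. if y k = 1 then g k else 0)"
    by (intro sum.cong) auto
  also have "\<dots> = sum g {k \<in> S. y k = 1}"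
    using assms by (rule sum.inter_filter[symmetric])
  finally show ?thesis .
qed

lemma sum_sym_diff_bit:
  fixes g :: "'a \<Rightarrow> bit"
  assumes "finite A" "finite B"
  shows "sum g (sym_diff A B) = sum g A + sum g B"
proof -
  have "sum g A = sum g (A - B) + sum g (A \<inter> B)"
    using sum.Int_Diff[OF assms(1), of g B] by (simp only: add.commute)
  moreover have "sum g B = sum g (B - A) + sum g (A \<inter> B)"
    using sum.Int_Diff[OF assms(2), of g A] by (simp only: add.commute Int_commute)
  moreover have "sum g (sym_diff A B) = sum g (A - B) + sum g (B - A)"
    using assms by (intro sum.union_disjoint) auto
  moreover have "a + b = (a + c) + (b + c)" for a b c :: bit
    by (cases a; cases b; cases c) auto
  ultimately show ?thesis by metis
qed

text \<open>A singular principal submatrix has a nonzero kernel vector, given here by its support \<open>F\<close>. Conversely, a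
trivial kernel makes the matrix act injectively, hence bijectively, on the finitely many subsets of
\<open>S\<close>; the preimages of singletons are the columns of a right inverse, and it is a left inverse as
well since \<open>A (B A - 1) = 0\<close>.\<close>

lemma nonsingular_on_iff:
  fixes A :: "'a \<Rightarrow> 'a \<Rightarrow> bit"
  assumes fin: "finite S"
  shows "nonsingular_on S A \<longleftrightarrow> (\<forall>F\<subseteq>S. (\<forall>i\<in>S. (\<Sum>k\<in>F. A i k) = 0) \<longrightarrow> F = {})"
proof
  assume "nonsingular_on S A"
  then obtain B where B: "\<And>i j. i \<in> S \<Longrightarrow> j \<in> S \<Longrightarrow> (\<Sum>k\<in>S. B i k * A k j) = (if i = j then 1 else 0)"
    unfolding nonsingular_on_def by blast
  show "\<forall>F\<subseteq>S. (\<forall>i\<in>S. (\<Sum>k\<in>F. A i k) = 0) \<longrightarrow> F = {}"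
  proof (intro allI impI)
    fix F assume F: "F \<subseteq> S" "\<forall>i\<in>S. (\<Sum>k\<in>F. A i k) = 0"
    have finF: "finite F" using F(1) fin finite_subset by blast
    have "i \<notin> F" if i: "i \<in> S" for i
    proof -
      have "(\<Sum>j\<in>F. if i = j then 1 else 0 :: bit) = (\<Sum>j\<in>F. \<Sum>k\<in>S. B i k * A k j)"
        using B i F(1) by (intro sum.cong) auto
      also have "\<dots> = (\<Sum>k\<in>S. \<Sum>j\<in>F. B i k * A k j)"
        by (rule sum.swap)
      also have "\<dots> = (\<Sum>k\<in>S. B i k * (\<Sum>j\<in>F. A k j))"
        by (simp only: sum_distrib_left)
      also have "\<dots> = 0" using F(2) by simp
      finally show ?thesis using finF by (simp split: if_splits)
    qed
    then show "F = {}" using F(1) by blast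
  qed
next
  assume ker: "\<forall>F\<subseteq>S. (\<forall>i\<in>S. (\<Sum>k\<in>F. A i k) = 0) \<longrightarrow> F = {}"
  define \<phi> where "\<phi> F = {i \<in> S. (\<Sum>k\<in>F. A i k) = 1}" for F
  have "inj_on \<phi> (Pow S)"
  proof (rule inj_onI)
    fix F G assume FG: "F \<in> Pow S" "G \<in> Pow S" "\<phi> F = \<phi> G"
    have "(\<Sum>k\<in>sym_diff F G. A i k) = 0" if "i \<in> S" for i
    proof -
      have "(\<Sum>k\<in>F. A i k) = (\<Sum>k\<in>G. A i k)"
      proof -
        have "i \<in> \<phi> F \<longleftrightarrow> i \<in> \<phi> G" using FG(3) by simp
        then show ?thesis
          using that by (cases "(\<Sum>k\<in>F. A i k) = 1") (auto simp: \<phi>_def)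
      qed
      then show ?thesis
        using FG fin by (subst sum_sym_diff_bit) (auto intro: finite_subset)
    qed
    then have "sym_diff F G = {}"
      using ker[rule_format, of "sym_diff F G"] FG(1,2) by blast
    then show "F = G" by blast
  qed
  then have "\<phi> ` Pow S = Pow S"
    using fin by (intro endo_inj_surj) (auto simp: \<phi>_def)
  then have "\<exists>b. b \<subseteq> S \<and> \<phi> b = {j}" if "j \<in> S" for j
  proof -
    have "{j} \<in> \<phi> ` Pow S" using that \<open>\<phi> ` Pow S = Pow S\<close> by simp
    then obtain b where "{j} = \<phi> b" "b \<in> Pow S" by (rule imageE)
    then show ?thesis by auto
  qed
  then obtain b where b: "\<And>j. j \<in> S \<Longrightarrow> b j \<subseteq> S" "\<And>j. j \<in> S \<Longrightarrow> \<phi> (b j) = {j}"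
    by metis
  define B where "B k j = (of_bool (k \<in> b j) :: bit)" for k j
  have right: "(\<Sum>k\<in>S. A i k * B k j) = (if i = j then 1 else 0)" if "i \<in> S" "j \<in> S" for i j
  proof -
    have "{k \<in> S. B k j = 1} = b j" using b(1)[OF that(2)] by (auto simp: B_def)
    then have "(\<Sum>k\<in>S. A i k * B k j) = (\<Sum>k\<in>b j. A i k)"
      using sum_mult_bit[OF fin, of "A i" "\<lambda>k. B k j"] by simp
    moreover have "(\<Sum>k\<in>b j. A i k) = 1 \<longleftrightarrow> i = j"
      using b(2)[OF that(2)] that(1) by (auto simp: \<phi>_def)
    ultimately show ?thesis by auto
  qed
  have left: "(\<Sum>k\<in>S. B i k * A k j) = (if i = j then 1 else 0)" if i: "i \<in> S" and j: "j \<in> S" for i j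
  proof -
    define y where "y i = (\<Sum>k\<in>S. B i k * A k j) + (if i = j then 1 else 0)" for i
    have "sum (A i) {k \<in> S. y k = 1} = 0" if i: "i \<in> S" for i
    proof -
      have "sum (A i) {k \<in> S. y k = 1} = (\<Sum>l\<in>S. A i l * y l)"
        by (rule sum_mult_bit[OF fin, symmetric])
      also have "\<dots> = (\<Sum>l\<in>S. A i l * (\<Sum>k\<in>S. B l k * A k j)) + (\<Sum>l\<in>S. A i l * (if l = j then 1 else 0))"
        unfolding y_def by (simp only: distrib_left sum.distrib)
      also have "(\<Sum>l\<in>S. A i l * (if l = j then 1 else 0)) = (\<Sum>l\<in>S. if l = j then A i l else 0)"
        by (intro sum.cong) auto
      also have "\<dots> = A i j"
        using fin j by (simp add: sum.delta)
      also have "(\<Sum>l\<in>S. A i l * (\<Sum>k\<in>S. B l k * A k j)) = (\<Sum>l\<in>S. \<Sum>k\<in>S. A i l * B l k * A k j)"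
        by (simp only: sum_distrib_left mult.assoc)
      also have "\<dots> = (\<Sum>k\<in>S. \<Sum>l\<in>S. A i l * B l k * A k j)"
        by (rule sum.swap)
      also have "\<dots> = (\<Sum>k\<in>S. (\<Sum>l\<in>S. A i l * B l k) * A k j)"
        by (simp only: sum_distrib_right)
      also have "\<dots> = (\<Sum>k\<in>S. if i = k then A k j else 0)"
        using right[OF i] by (intro sum.cong) auto
      also have "\<dots> = A i j"
        using fin i by (simp add: sum.delta')
      finally show ?thesis by simp
    qed
    then have "{k \<in> S. y k = 1} = {}"
      using ker[rule_format, of "{k \<in> S. y k = 1}"] by auto
    then have "y i = 0" using i by auto
    then show ?thesis by (auto simp: y_def)
  qed
  show "nonsingular_on S A"
    unfolding nonsingular_on_def using right left by blast
qed

lemma nonsingular_on_image: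
  assumes "finite S" "inj_on f S"
  shows "nonsingular_on (f ` S) A \<longleftrightarrow> nonsingular_on S (\<lambda>i j. A (f i) (f j))"
proof -
  have "(\<Sum>k\<in>f ` F. A i k) = (\<Sum>k\<in>F. A i (f k))" if "F \<subseteq> S" for F i
    using inj_on_subset[OF assms(2) that] by (simp add: sum.reindex)
  then show ?thesis
    using assms(1) by (simp add: nonsingular_on_iff all_subset_image)
qed

text \<open>The vector \<open>(A x, x)\<close>, where \<open>x\<close> is the indicator vector of \<open>F\<close>, with its two components swapped in
the coordinates belonging to \<open>X\<close>. The swap realises the twist by \<open>X\<close>.\<close>

definition graph_vector :: "'a set \<Rightarrow> ('a \<Rightarrow> 'a \<Rightarrow> bit) \<Rightarrow> 'a set \<Rightarrow> 'a set \<Rightarrow> 'a \<Rightarrow> bit \<times> bit" where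
  "graph_vector E A X F e =
    (if e \<notin> E then 0
     else if e \<in> X then (of_bool (e \<in> F), \<Sum>k\<in>F. A e k) else (\<Sum>k\<in>F. A e k, of_bool (e \<in> F)))"

lemma lagrangian_graph:
  fixes A :: "'a \<Rightarrow> 'a \<Rightarrow> bit"
  assumes fin: "finite E" and sym: "\<And>i j. i \<in> E \<Longrightarrow> j \<in> E \<Longrightarrow> A i j = A j i"
  shows "lagrangian E (graph_vector E A X ` Pow E)"
proof
  show "finite E" by fact
next
  fix v e assume "v \<in> graph_vector E A X ` Pow E" "e \<notin> E"
  then show "v e = 0" by (auto simp: graph_vector_def)
next
  have "graph_vector E A X {} = (\<lambda>_. 0)"
    by (auto simp: graph_vector_def zero_prod_def)
  then show "(\<lambda>_. 0) \<in> graph_vector E A X ` Pow E"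
    by (metis Pow_bottom imageI)
next
  fix v w assume "v \<in> graph_vector E A X ` Pow E" "w \<in> graph_vector E A X ` Pow E"
  then obtain F G where FG: "F \<subseteq> E" "G \<subseteq> E" "v = graph_vector E A X F" "w = graph_vector E A X G"
    by blast
  have finFG: "finite F" "finite G" using FG fin finite_subset by auto
  have ob: "(of_bool (e \<in> F) + of_bool (e \<in> G) :: bit) = of_bool (e \<in> sym_diff F G)" for e
    by auto
  have "(\<lambda>e. v e + w e) = graph_vector E A X (sym_diff F G)"
    unfolding FG graph_vector_def sum_sym_diff_bit[OF finFG] ob[symmetric] by (auto simp: fun_eq_iff)
  then show "(\<lambda>e. v e + w e) \<in> graph_vector E A X ` Pow E"
    using FG by blast
  have "(\<Sum>e\<in>E. sform (v e) (w e))
      = (\<Sum>e\<in>E. (\<Sum>k\<in>G. A e k) * of_bool (e \<in> F) + (\<Sum>k\<in>F. A e k) * of_bool (e \<in> G))"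
    unfolding FG graph_vector_def by (intro sum.cong) (auto simp: sform_def)
  also have "\<dots> = (\<Sum>e\<in>F. \<Sum>k\<in>G. A e k) + (\<Sum>e\<in>G. \<Sum>k\<in>F. A e k)"
  proof -
    have "{k \<in> E. (of_bool (k \<in> F) :: bit) = 1} = F" "{k \<in> E. (of_bool (k \<in> G) :: bit) = 1} = G"
      using FG by auto
    then show ?thesis
      by (simp only: sum.distrib sum_mult_bit[OF fin])
  qed
  also have "(\<Sum>e\<in>G. \<Sum>k\<in>F. A e k) = (\<Sum>k\<in>F. \<Sum>e\<in>G. A e k)"
    by (rule sum.swap)
  also have "\<dots> = (\<Sum>e\<in>F. \<Sum>k\<in>G. A e k)"
    using FG sym by (intro sum.cong refl) blast
  finally show "(\<Sum>e\<in>E. sform (v e) (w e)) = 0" by simp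
next
  have "inj_on (graph_vector E A X) (Pow E)"
  proof (rule inj_onI)
    fix F G assume FG: "F \<in> Pow E" "G \<in> Pow E" "graph_vector E A X F = graph_vector E A X G"
    have "e \<in> F \<longleftrightarrow> e \<in> G" if "e \<in> E" for e
      using fun_cong[OF FG(3), of e] that by (auto simp: graph_vector_def split: if_splits)
    then show "F = G" using FG(1,2) by blast
  qed
  then show "card (graph_vector E A X ` Pow E) = 2 ^ card E"
    using fin by (simp add: card_image card_Pow)
qed

text \<open>A vector \<open>(A x, x)\<close> is supported on the transversal of \<open>Y\<close> exactly when \<open>x\<close> vanishes off the symmetric
difference \<open>S\<close> of \<open>Y\<close> and \<open>X\<close> while \<open>A x\<close> vanishes on \<open>S\<close>, that is, when \<open>x\<close> is in the kernel
of \<open>A[S]\<close>.\<close>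

lemma feasible_sys_graph_iff:
  fixes A :: "'a \<Rightarrow> 'a \<Rightarrow> bit"
  assumes fin: "finite E" and sym: "\<And>i j. i \<in> E \<Longrightarrow> j \<in> E \<Longrightarrow> A i j = A j i"
    and X: "X \<subseteq> E" and Y: "Y \<subseteq> E"
  shows "Y \<in> feasible (lagrangian.sys E (graph_vector E A X ` Pow E) (1, 0) (0, 1))
    \<longleftrightarrow> nonsingular_on (sym_diff Y X) A"
proof -
  interpret lagrangian E "graph_vector E A X ` Pow E"
    by (rule lagrangian_graph[OF fin sym])
  define S where "S = sym_diff Y X"
  have SE: "S \<subseteq> E" using X Y by (auto simp: S_def)
  have finS: "finite S" using SE fin by (rule finite_subset)
  have supp: "supported (graph_vector E A X F) (\<lambda>e. if e \<in> Y then (0, 1) else (1, 0))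
      \<longleftrightarrow> F \<subseteq> S \<and> (\<forall>i\<in>S. (\<Sum>k\<in>F. A i k) = 0)" if "F \<subseteq> E" for F
  proof -
    have "graph_vector E A X F e = 0 \<or> graph_vector E A X F e = (if e \<in> Y then (0, 1) else (1, 0))
      \<longleftrightarrow> (if e \<in> S then (\<Sum>k\<in>F. A e k) = 0 else e \<notin> F)" if "e \<in> E" for e
      using that by (auto simp: graph_vector_def S_def zero_prod_def)
    then show ?thesis
      unfolding supported_def using SE that by (auto split: if_splits)
  qed
  have zero: "graph_vector E A X F = (\<lambda>_. 0) \<longleftrightarrow> F = {}" if "F \<subseteq> E" for F
  proof
    assume z: "graph_vector E A X F = (\<lambda>_. 0)"
    have "e \<notin> F" if "e \<in> E" for e
      using fun_cong[OF z, of e] that by (auto simp: graph_vector_def zero_prod_def split: if_splits)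
    then show "F = {}" using that by blast
  qed (auto simp: graph_vector_def zero_prod_def)
  have "basis (\<lambda>e. if e \<in> Y then (0, 1) else (1, 0))
      \<longleftrightarrow> (\<forall>F\<subseteq>E. F \<subseteq> S \<and> (\<forall>i\<in>S. (\<Sum>k\<in>F. A i k) = 0) \<longrightarrow> F = {})"
  proof -
    have "basis (\<lambda>e. if e \<in> Y then (0, 1) else (1, 0)) \<longleftrightarrow>
      (\<forall>F\<subseteq>E. supported (graph_vector E A X F) (\<lambda>e. if e \<in> Y then (0, 1) else (1, 0))
        \<longrightarrow> graph_vector E A X F = (\<lambda>_. 0))"
      unfolding basis_def by blast
    then show ?thesis
      using supp zero by auto
  qed
  also have "\<dots> \<longleftrightarrow> nonsingular_on S A"
    unfolding nonsingular_on_iff[OF finS] using SE by (meson order_trans)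
  finally show ?thesis
    using Y by (simp add: feasible_sys S_def)
qed

text \<open>An isomorphism onto the set system of a matrix only relabels the rows and columns, so it can be moved
into the matrix; the twist is absorbed by the swapped coordinates of the graph.\<close>

theorem binary_imp_sys:
  fixes D :: "'a set_system"
  assumes D: "delta_matroid D" and "binary D"
  obtains L where "lagrangian (ground D) L" "D = lagrangian.sys (ground D) L (1, 0) (0, 1)"
proof -
  define E where "E = ground D"
  obtain X A and V :: "'a set" where X: "X \<subseteq> E" and V: "finite V" "\<forall>i\<in>V. \<forall>j\<in>V. A i j = A j i"
    and iso: "isomorphic (twist D X) (matrix_system V A)"
    using \<open>binary D\<close> unfolding binary_def E_def by blast
  then obtain f where f: "bij_betw f E V"
    and feas: "feasible (matrix_system V A) = (`) f ` feasible (twist D X)"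
    by (auto simp: isomorphic_def twist_def matrix_system_def E_def)
  have fin: "finite E" and sub: "feasible D \<subseteq> Pow E"
    using D by (auto simp: delta_matroid_def E_def)
  define A' where "A' i j = A (f i) (f j)" for i j
  have sym: "A' i j = A' j i" if "i \<in> E" "j \<in> E" for i j
    using V(2) that bij_betwE[OF f] by (simp add: A'_def)
  define L where "L = graph_vector E A' X ` Pow E"
  interpret lagrangian E L
    unfolding L_def by (rule lagrangian_graph[OF fin sym])
  have "D = sys (1, 0) (0, 1)"
  proof (rule set_system_eqI)
    fix Y
    show "Y \<in> feasible D \<longleftrightarrow> Y \<in> feasible (sys (1, 0) (0, 1))"
    proof (cases "Y \<subseteq> E")
      case True
      define S where "S = sym_diff Y X"
      have SE: "S \<subseteq> E" using True X by (auto simp: S_def)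
      have tw: "S' \<in> feasible (twist D X) \<longleftrightarrow> sym_diff S' X \<in> feasible D" for S'
      proof
        assume "S' \<in> feasible (twist D X)"
        then obtain F where F: "F \<in> feasible D" "S' = sym_diff F X"
          by (auto simp: twist_def)
        have "sym_diff S' X = F" unfolding F(2) by blast
        then show "sym_diff S' X \<in> feasible D" using F(1) by simp
      next
        assume "sym_diff S' X \<in> feasible D"
        moreover have "S' = sym_diff (sym_diff S' X) X" by blast
        ultimately have "S' \<in> (\<lambda>F. sym_diff F X) ` feasible D" by (rule rev_image_eqI)
        then show "S' \<in> feasible (twist D X)" by (simp add: twist_def)
      qed
      have "sym_diff S X = Y" by (auto simp: S_def)
      then have "Y \<in> feasible D \<longleftrightarrow> S \<in> feasible (twist D X)"
        using tw[of S] by simp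
      also have "\<dots> \<longleftrightarrow> f ` S \<in> feasible (matrix_system V A)"
      proof -
        have "feasible (twist D X) \<subseteq> Pow E"
          using sub X by (auto simp: twist_def)
        moreover have "inj_on ((`) f) (Pow E)"
          using f by (simp add: bij_betw_def inj_on_image_Pow)
        ultimately show ?thesis
          unfolding feas using SE by (subst inj_on_image_mem_iff) auto
      qed
      also have "\<dots> \<longleftrightarrow> nonsingular_on (f ` S) A"
        using SE f by (auto simp: matrix_system_def bij_betw_def)
      also have "\<dots> \<longleftrightarrow> nonsingular_on S A'"
        unfolding A'_def using SE f fin
        by (intro nonsingular_on_image) (auto simp: bij_betw_def intro: finite_subset inj_on_subset)
      also have "\<dots> \<longleftrightarrow> Y \<in> feasible (sys (1, 0) (0, 1))"
        unfolding S_def L_def using feasible_sys_graph_iff[OF fin sym X True] by simp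
      finally show ?thesis .
    next
      case False
      then show ?thesis using sub by (auto simp: feasible_sys)
    qed
  qed (simp add: E_def[symmetric])
  then show thesis
    using that lagrangian_axioms unfolding E_def by blast
qed

section \<open>Tight 3-matroids on a labelled carrier\<close>

lemma label_class: "{t e 1, t e 2, t e 3} = range (t e)" for t :: "'a \<Rightarrow> 3 \<Rightarrow> 'u"
  by (simp add: UNIV_3)

locale labelled =
  fixes E :: "'a set" and t :: "'a \<Rightarrow> 3 \<Rightarrow> 'u"
  assumes finite_ground: "finite E" and lab: "labelling E t"
begin

lemma t_eq_iff: "e \<in> E \<Longrightarrow> f \<in> E \<Longrightarrow> t e i = t f j \<longleftrightarrow> e = f \<and> i = j"
  using lab unfolding labelling_def inj_on_def by fastforce

definition on_carrier :: "'u multimatroid \<Rightarrow> bool" where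
  "on_carrier Z \<longleftrightarrow> elements Z = (\<Union>e\<in>E. {t e 1, t e 2, t e 3}) \<and>
     skew_classes Z = {{t e 1, t e 2, t e 3} |e. e \<in> E}"

text \<open>The transversals of a carrier are exactly the sets of this form.\<close>

definition select :: "('a \<Rightarrow> 3) \<Rightarrow> 'u set" where
  "select s = (\<lambda>e. t e (s e)) ` E"

lemma on_carrier_eqs:
  assumes "on_carrier Z"
  shows "elements Z = (\<Union>e\<in>E. range (t e))" "skew_classes Z = (\<lambda>e. range (t e)) ` E"
  using assms unfolding on_carrier_def label_class by auto

lemma mem_select: "e \<in> E \<Longrightarrow> t e i \<in> select s \<longleftrightarrow> i = s e"
  by (auto simp: select_def t_eq_iff)

lemma select_cong: "(\<And>e. e \<in> E \<Longrightarrow> s e = s' e) \<Longrightarrow> select s = select s'"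
  by (simp add: select_def)

lemma select_update:
  assumes "e \<in> E"
  shows "select s - range (t e) \<union> {t e i} = select (s(e := i))"
proof -
  define R where "R = (\<lambda>f. t f (s f)) ` (E - {e})"
  have E: "E = insert e (E - {e})" using assms by blast
  have "(\<lambda>f. t f ((s(e := i)) f)) ` (E - {e}) = R"
    unfolding R_def by (intro image_cong) auto
  moreover have "(\<lambda>f. t f ((s(e := i)) f)) ` E = insert (t e i) ((\<lambda>f. t f ((s(e := i)) f)) ` (E - {e}))"
    by (subst E, subst image_insert) simp
  ultimately have "select (s(e := i)) = insert (t e i) R"
    by (simp only: select_def)
  moreover have "select s = insert (t e (s e)) R"
    unfolding select_def R_def by (subst E, subst image_insert) simp
  moreover have "R \<inter> range (t e) = {}"
    using assms by (auto simp: R_def t_eq_iff)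
  ultimately show ?thesis by blast
qed

lemma finite_carrier: "on_carrier Z \<Longrightarrow> finite (elements Z)"
  using finite_ground by (simp add: on_carrier_def)

lemma partition_carrier: "on_carrier Z \<Longrightarrow> partition_on (elements Z) (skew_classes Z)"
  by (auto simp: on_carrier_eqs partition_on_def disjoint_def t_eq_iff)

lemma card_skew_class:
  assumes "on_carrier Z" "\<omega> \<in> skew_classes Z"
  shows "card \<omega> = 3"
proof -
  obtain e where e: "e \<in> E" "\<omega> = range (t e)"
    using assms by (auto simp: on_carrier_eqs)
  then have "inj (t e)" by (auto simp: inj_def t_eq_iff)
  then show ?thesis using e by (simp add: card_image)
qed

lemma subtransversal_iff:
  assumes "on_carrier Z"
  shows "subtransversal Z S \<longleftrightarrow>
    S \<subseteq> (\<Union>e\<in>E. range (t e)) \<and> (\<forall>e\<in>E. \<forall>i j. t e i \<in> S \<longrightarrow> t e j \<in> S \<longrightarrow> i = j)"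
proof -
  have "card (S \<inter> range (t e)) \<le> 1 \<longleftrightarrow> (\<forall>i j. t e i \<in> S \<longrightarrow> t e j \<in> S \<longrightarrow> i = j)" if "e \<in> E" for e
  proof -
    have "card (S \<inter> range (t e)) \<le> 1 \<longleftrightarrow> (\<forall>a\<in>S \<inter> range (t e). \<forall>b\<in>S \<inter> range (t e). a = b)"
      by (simp add: card_le_Suc0_iff_eq)
    moreover have "t e i = t e j \<longleftrightarrow> i = j" for i j
      using that by (simp add: t_eq_iff)
    ultimately show ?thesis by blast
  qed
  then show ?thesis
    by (auto simp: subtransversal_def on_carrier_eqs[OF assms])
qed

lemma transversal_select:
  assumes "on_carrier Z"
  shows "transversal Z (select s)"
proof -
  have "select s \<inter> range (t e) = {t e (s e)}" if "e \<in> E" for e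
    using that by (auto simp: select_def t_eq_iff)
  then show ?thesis
    by (auto simp: transversal_def on_carrier_eqs[OF assms] select_def)
qed

lemma subtransversal_meeting_all:
  assumes Z: "on_carrier Z" and S: "subtransversal Z S"
    and meets: "\<And>e. e \<in> E \<Longrightarrow> \<exists>i. t e i \<in> S"
  shows "\<exists>s. S = select s"
proof -
  from meets obtain s where s: "\<And>e. e \<in> E \<Longrightarrow> t e (s e) \<in> S" by metis
  have S': "S \<subseteq> (\<Union>e\<in>E. range (t e))" "\<And>e i j. e \<in> E \<Longrightarrow> t e i \<in> S \<Longrightarrow> t e j \<in> S \<Longrightarrow> i = j"
    using S unfolding subtransversal_iff[OF Z] by auto
  have "S = select s"
  proof
    show "S \<subseteq> select s"
    proof
      fix x assume x: "x \<in> S"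
      then obtain e i where e: "e \<in> E" "x = t e i" using S'(1) by blast
      then have "i = s e" using S'(2)[of e i "s e"] s x by simp
      then show "x \<in> select s" using e by (simp add: mem_select)
    qed
  qed (use s in \<open>auto simp: select_def\<close>)
  then show ?thesis by (rule exI[of _ s])
qed

lemma transversal_iff:
  assumes "on_carrier Z"
  shows "transversal Z S \<longleftrightarrow> (\<exists>s. S = select s)"
proof
  assume S: "transversal Z S"
  then have "subtransversal Z S"
    by (auto simp: transversal_def subtransversal_def)
  moreover have "\<exists>i. t e i \<in> S" if "e \<in> E" for e
  proof -
    have "card (S \<inter> range (t e)) = 1"
      using S that by (auto simp: transversal_def on_carrier_eqs[OF assms])
    then have "S \<inter> range (t e) \<noteq> {}" by auto
    then show ?thesis by auto
  qed
  ultimately show "\<exists>s. S = select s"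
    by (rule subtransversal_meeting_all[OF assms])
qed (use transversal_select[OF assms] in auto)

lemma select_subset_subtransversal:
  assumes Z: "on_carrier Z" and "subtransversal Z I" "select s \<subseteq> I"
  shows "I = select s"
proof -
  have I: "I \<subseteq> (\<Union>e\<in>E. range (t e))" "\<And>e i j. e \<in> E \<Longrightarrow> t e i \<in> I \<Longrightarrow> t e j \<in> I \<Longrightarrow> i = j"
    using assms(2) unfolding subtransversal_iff[OF Z] by auto
  have "I \<subseteq> select s"
  proof
    fix x assume x: "x \<in> I"
    then obtain e i where e: "e \<in> E" "x = t e i" using I(1) by blast
    moreover have "t e (s e) \<in> I" using assms(3) e(1) by (auto simp: select_def)
    ultimately have "i = s e" using I(2)[of e i "s e"] x by simp
    then show "x \<in> select s" using e by (simp add: mem_select)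
  qed
  then show ?thesis
    using assms(3) by blast
qed

text \<open>By the second multimatroid axiom an independent set that misses a skew class can be
extended into it, so bases are transversals.\<close>

lemma maximal_indep_is_select:
  assumes Z: "on_carrier Z" "multimatroid Z" and I: "I \<in> indep Z"
    and maxi: "\<And>J. J \<in> indep Z \<Longrightarrow> I \<subseteq> J \<Longrightarrow> J = I"
  shows "\<exists>s. I = select s"
proof (rule subtransversal_meeting_all[OF Z(1)])
  show "subtransversal Z I" using Z(2) I by (auto simp: multimatroid_def)
next
  fix e assume e: "e \<in> E"
  show "\<exists>i. t e i \<in> I"
  proof (rule ccontr)
    assume no: "\<nexists>i. t e i \<in> I"
    then have "range (t e) \<inter> I = {}" by auto
    moreover have "t e 1 \<noteq> t e 2" using e by (simp add: t_eq_iff)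
    moreover have "range (t e) \<in> skew_classes Z" using e by (simp add: on_carrier_eqs[OF Z(1)])
    ultimately have "I \<union> {t e 1} \<in> indep Z \<or> I \<union> {t e 2} \<in> indep Z"
      using Z(2) I unfolding multimatroid_def by blast
    then show False using maxi[of "I \<union> {t e 1}"] maxi[of "I \<union> {t e 2}"] no by blast
  qed
qed

lemma bases_iff:
  assumes Z: "on_carrier Z" "multimatroid Z"
  shows "B \<in> bases Z \<longleftrightarrow> B \<in> indep Z \<and> (\<exists>s. B = select s)"
proof
  assume "B \<in> bases Z"
  then show "B \<in> indep Z \<and> (\<exists>s. B = select s)"
    using maximal_indep_is_select[OF Z, of B] by (auto simp: bases_def)
next
  assume B: "B \<in> indep Z \<and> (\<exists>s. B = select s)"
  have "subtransversal Z I" if "I \<in> indep Z" for I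
    using that Z(2) by (simp add: multimatroid_def)
  then show "B \<in> bases Z"
    using B select_subset_subtransversal[OF Z(1)] by (auto simp: bases_def)
qed

lemma indep_iff_subset_select:
  assumes Z: "on_carrier Z" "multimatroid Z"
  shows "I \<in> indep Z \<longleftrightarrow> (\<exists>s. I \<subseteq> select s \<and> select s \<in> indep Z)"
proof
  assume I: "I \<in> indep Z"
  have "indep Z \<subseteq> Pow (elements Z)"
    using Z(2) by (auto simp: multimatroid_def subtransversal_def)
  then have "finite (indep Z)"
    using finite_carrier[OF Z(1)] finite_subset by auto
  from finite_has_maximal2[OF this I] obtain J
    where J: "J \<in> indep Z" "I \<subseteq> J" "\<forall>K\<in>indep Z. J \<subseteq> K \<longrightarrow> J = K"
    by auto
  obtain s where "J = select s"
    using maximal_indep_is_select[OF Z J(1)] J(3) by auto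
  then show "\<exists>s. I \<subseteq> select s \<and> select s \<in> indep Z"
    using J(1,2) by auto
next
  assume "\<exists>s. I \<subseteq> select s \<and> select s \<in> indep Z"
  then obtain s where s: "I \<subseteq> select s" "select s \<in> indep Z" by blast
  have "matroid (select s, indep Z \<inter> Pow (select s))"
    using Z(2) transversal_select[OF Z(1)] by (simp add: multimatroid_def)
  then have "\<forall>K\<in>indep Z \<inter> Pow (select s). \<forall>J. J \<subseteq> K \<longrightarrow> J \<in> indep Z \<inter> Pow (select s)"
    unfolding matroid_def prod.case by (elim conjE)
  from this[rule_format, of "select s" I] show "I \<in> indep Z" using s by simp
qed

lemma feasible_system_of_iff:
  assumes Z: "on_carrier Z" "multimatroid Z"
  shows "X \<in> feasible (system_of E t Z) \<longleftrightarrow>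
    X \<subseteq> E \<and> select (\<lambda>e. if e \<in> X then 2 else 1) \<in> indep Z"
proof (cases "X \<subseteq> E")
  case True
  let ?S = "select (\<lambda>e. if e \<in> X then 2 else 1)"
  have eq: "{t e 1 |e. e \<in> E - X} \<union> {t e 2 |e. e \<in> X} = ?S"
  proof -
    have "(\<lambda>e. t e (if e \<in> X then 2 else 1)) ` ((E - X) \<union> X) = {t e 1 |e. e \<in> E - X} \<union> {t e 2 |e. e \<in> X}"
      unfolding image_Un Setcompr_eq_image by (intro arg_cong2[of _ _ _ _ "(\<union>)"] image_cong) auto
    moreover have "(E - X) \<union> X = E" using True by blast
    ultimately show ?thesis by (simp add: select_def)
  qed
  have "?S \<inter> T_class E t 3 = {}"
    by (auto simp: T_class_def mem_select split: if_splits)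
  moreover have "?S \<subseteq> elements Z"
    by (auto simp: select_def on_carrier_eqs[OF Z(1)])
  moreover have "I = ?S" if "I \<in> indep Z" "?S \<subseteq> I" for I
    using that Z by (intro select_subset_subtransversal) (auto simp: multimatroid_def)
  ultimately have "?S \<in> bases (delete Z (T_class E t 3)) \<longleftrightarrow> ?S \<in> indep Z"
    by (auto simp: bases_def delete_def)
  then show ?thesis
    using True eq by (simp add: system_of_def)
qed (simp add: system_of_def)

text \<open>Once a skew class admits some basis, tightness leaves exactly one of its three elements out. So whether
the element with label 3 gives a basis is determined by the other two.\<close>

lemma tight_third_iff:
  assumes Z: "on_carrier Z" "tight_3_matroid Z" and e: "e \<in> E"
  shows "select (s(e := 3)) \<in> indep Z \<longleftrightarrow>
    (select (s(e := 1)) \<in> indep Z) \<noteq> (select (s(e := 2)) \<in> indep Z)"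
proof -
  have mm: "multimatroid Z" using Z(2) by (simp add: tight_3_matroid_def)
  have sel: "select r \<in> bases Z \<longleftrightarrow> select r \<in> indep Z" for r
    using bases_iff[OF Z(1) mm] by blast
  have key: "\<exists>k. \<forall>j. select (s(e := j)) \<in> indep Z \<longleftrightarrow> j \<noteq> k"
    if i: "select (s(e := i)) \<in> indep Z" for i
  proof -
    have upd: "select (s(e := i)) - range (t e) \<union> {t e j} = select (s(e := j))" for j
      using select_update[OF e, of "s(e := i)" j] by simp
    have "\<exists>!u. u \<in> range (t e) \<and> select (s(e := i)) - range (t e) \<union> {u} \<notin> bases Z"
      using Z(2) i sel e unfolding tight_3_matroid_def by (auto simp: on_carrier_eqs[OF Z(1)])
    then obtain u where u: "u \<in> range (t e)" "select (s(e := i)) - range (t e) \<union> {u} \<notin> bases Z"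
      "\<And>u'. u' \<in> range (t e) \<Longrightarrow> select (s(e := i)) - range (t e) \<union> {u'} \<notin> bases Z \<Longrightarrow> u' = u"
      by blast
    then obtain k where k: "u = t e k" by blast
    have "select (s(e := j)) \<in> indep Z \<longleftrightarrow> j \<noteq> k" for j
      using u(2) u(3)[of "t e j"] unfolding k upd sel by (auto simp: t_eq_iff e)
    then show ?thesis by blast
  qed
  show ?thesis
  proof (cases "\<exists>i. select (s(e := i)) \<in> indep Z")
    case True
    then obtain k where k: "\<And>j. select (s(e := j)) \<in> indep Z \<longleftrightarrow> j \<noteq> k"
      using key by blast
    show ?thesis
      unfolding k using exhaust_3[of k] by auto
  qed auto
qed

text \<open>The set system fixes which transversals avoiding \<open>T\<^sub>3\<close> are bases, and \<open>tight_third_iff\<close>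
propagates this by induction on the number of elements of \<open>T\<^sub>3\<close>. The bases determine the independent
sets.\<close>

lemma tight_3_matroid_unique:
  assumes Z: "on_carrier Z" "tight_3_matroid Z" and Z': "on_carrier Z'" "tight_3_matroid Z'"
    and eq: "system_of E t Z = system_of E t Z'"
  shows "Z = Z'"
proof -
  have mm: "multimatroid Z" "multimatroid Z'"
    using Z Z' by (auto simp: tight_3_matroid_def)
  have sel: "select s \<in> indep Z \<longleftrightarrow> select s \<in> indep Z'" for s
  proof (induction "card {e \<in> E. s e = 3}" arbitrary: s rule: less_induct)
    case less
    show ?case
    proof (cases "\<exists>e\<in>E. s e = 3")
      case True
      then obtain e where e: "e \<in> E" "s e = 3" by blast
      have "select (s(e := i)) \<in> indep Z \<longleftrightarrow> select (s(e := i)) \<in> indep Z'" if "i \<noteq> 3" for i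
      proof (rule less)
        show "card {f \<in> E. (s(e := i)) f = 3} < card {f \<in> E. s f = 3}"
          using e that finite_ground by (intro psubset_card_mono) auto
      qed
      from this[of 1] this[of 2] show ?thesis
        using tight_third_iff[OF Z e(1), of s] tight_third_iff[OF Z' e(1), of s] e(2)
        by (simp add: fun_upd_idem)
    next
      case False
      define X where "X = {e \<in> E. s e = 2}"
      have "select s = select (\<lambda>e. if e \<in> X then 2 else 1)"
        using False exhaust_3 by (intro select_cong) (auto simp: X_def)
      moreover have "X \<subseteq> E" by (auto simp: X_def)
      ultimately show ?thesis
        using feasible_system_of_iff[OF Z(1) mm(1), of X] feasible_system_of_iff[OF Z'(1) mm(2), of X] eq
        by simp
    qed
  qed
  have "indep Z = indep Z'"
  proof (rule set_eqI)
    fix I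
    show "I \<in> indep Z \<longleftrightarrow> I \<in> indep Z'"
      using indep_iff_subset_select[OF Z(1) mm(1), of I] indep_iff_subset_select[OF Z'(1) mm(2), of I]
      by (simp add: sel)
  qed
  moreover have "elements Z = elements Z'" "skew_classes Z = skew_classes Z'"
    using Z(1) Z'(1) by (auto simp: on_carrier_def)
  ultimately show ?thesis
    by (cases Z; cases Z') auto
qed

end

section \<open>Matroids defined by a cycle space\<close>

text \<open>If no element of \<open>J\<close> augments \<open>I\<close>, then every subset of \<open>J\<close> is congruent modulo \<open>\<C>\<close> to
a subset of \<open>I\<close>. Distinct subsets of \<open>J\<close> are incongruent as \<open>J\<close> contains no nonempty
member of \<open>\<C>\<close>. Hence \<open>J\<close> has at most as many subsets as \<open>I\<close>.\<close>

lemma matroid_of_cycle_space: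
  assumes fin: "finite T"
    and closed: "\<And>C C'. C \<in> \<C> \<Longrightarrow> C' \<in> \<C> \<Longrightarrow> C \<subseteq> T \<Longrightarrow> C' \<subseteq> T \<Longrightarrow> sym_diff C C' \<in> \<C>"
    and empty: "{} \<in> \<C>"
  shows "matroid (T, {I. I \<subseteq> T \<and> (\<forall>C\<in>\<C>. C \<subseteq> I \<longrightarrow> C = {})})" (is "matroid (T, ?I)")
proof -
  have augment: "\<exists>x\<in>J - I. insert x I \<in> ?I" if I: "I \<in> ?I" and J: "J \<in> ?I" and less: "card I < card J" for I J
  proof (rule ccontr)
    assume con: "\<not> ?thesis"
    have finI: "finite I" "finite J" using I J fin finite_subset by auto
    have circ: "\<exists>C\<in>\<C>. C \<subseteq> insert x I \<and> x \<in> C" if x: "x \<in> J - I" for x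
    proof -
      have "insert x I \<subseteq> T" using x I J by auto
      then have "\<not> (\<forall>C\<in>\<C>. C \<subseteq> insert x I \<longrightarrow> C = {})" using con x by auto
      then obtain C where "C \<in> \<C>" "C \<subseteq> insert x I" "C \<noteq> {}" by blast
      moreover have "\<not> C \<subseteq> I" using calculation I by auto
      ultimately show ?thesis by blast
    qed
    \<comment> \<open>adding the cycle through \<open>x\<close> removes \<open>x\<close> and changes \<open>Y\<close> otherwise only inside \<open>I\<close>\<close>
    have reduce: "\<exists>Y'\<subseteq>I. sym_diff Y Y' \<in> \<C>" if Y: "Y \<subseteq> I \<union> J" for Y
      using Y
    proof (induction "card (Y - I)" arbitrary: Y rule: less_induct)
      case less
      show ?case
      proof (cases "Y \<subseteq> I")
        case True
        then show ?thesis using empty by (intro exI[of _ Y]) auto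
      next
        case False
        then obtain x where x: "x \<in> Y" "x \<notin> I" by blast
        obtain C where C: "C \<in> \<C>" "C \<subseteq> insert x I" "x \<in> C"
          using circ[of x] x less(2) by blast
        have "sym_diff Y C - I \<subset> Y - I" using C x by blast
        moreover have "finite (Y - I)" using less(2) finI finite_subset[of Y "I \<union> J"] by auto
        ultimately have "card (sym_diff Y C - I) < card (Y - I)" by (intro psubset_card_mono)
        moreover have "sym_diff Y C \<subseteq> I \<union> J" using less(2) C x by blast
        ultimately obtain Y' where Y': "Y' \<subseteq> I" "sym_diff (sym_diff Y C) Y' \<in> \<C>"
          using less(1)[of "sym_diff Y C"] by blast
        have sub: "I \<subseteq> T" "J \<subseteq> T" using I J by auto
        have "sym_diff (sym_diff (sym_diff Y C) Y') C \<in> \<C>"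
          by (rule closed[OF Y'(2) C(1)]) (use Y' C x less(2) sub in blast)+
        moreover have "sym_diff (sym_diff (sym_diff Y C) Y') C = sym_diff Y Y'" by blast
        ultimately show ?thesis using Y'(1) by auto
      qed
    qed
    then have "\<forall>Y\<in>Pow J. \<exists>Y'\<in>Pow I. sym_diff Y Y' \<in> \<C>" by (metis PowD PowI le_supI2)
    then obtain g where g: "\<And>Y. Y \<in> Pow J \<Longrightarrow> g Y \<in> Pow I" "\<And>Y. Y \<in> Pow J \<Longrightarrow> sym_diff Y (g Y) \<in> \<C>"
      by metis
    have "inj_on g (Pow J)"
    proof (rule inj_onI)
      fix Y W assume YW: "Y \<in> Pow J" "W \<in> Pow J" "g Y = g W"
      have sub: "I \<subseteq> T" "J \<subseteq> T" using I J by auto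
      have "sym_diff (sym_diff Y (g Y)) (sym_diff W (g W)) \<in> \<C>"
        by (rule closed[OF g(2)[OF YW(1)] g(2)[OF YW(2)]]) (use YW g(1)[OF YW(1)] g(1)[OF YW(2)] sub in blast)+
      moreover have "sym_diff (sym_diff Y (g Y)) (sym_diff W (g W)) = sym_diff Y W"
        unfolding YW(3) by blast
      moreover have "sym_diff Y W \<subseteq> J" using YW by blast
      ultimately have "sym_diff Y W = {}" using J by auto
      then show "Y = W" by blast
    qed
    then have "card (Pow J) \<le> card (Pow I)"
      using g(1) finI by (intro card_inj_on_le[of g]) auto
    then show False using less finI by (simp add: card_Pow)
  qed
  show ?thesis
    unfolding matroid_def using fin augment by auto
qed

section \<open>The tight 3-matroid of a Lagrangian subspace\<close>

definition col :: "3 \<Rightarrow> bit \<times> bit" where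
  "col i = (if i = 1 then (1, 0) else if i = 2 then (0, 1) else (1, 1))"

lemma col_simps: "col 1 = (1, 0)" "col 2 = (0, 1)" "col 3 = (1, 1)"
  by (auto simp: col_def)

lemma col_nonzero [simp]: "col i \<noteq> 0"
  by (simp add: col_def zero_prod_def)

lemma col_eq_iff [simp]: "col i = col j \<longleftrightarrow> i = j"
  using exhaust_3[of i] exhaust_3[of j] by (auto simp: col_simps)

lemma col_cases:
  assumes "x \<noteq> 0"
  obtains i where "x = col i"
proof -
  have "x = col 1 \<or> x = col 2 \<or> x = col 3"
    using assms by (cases x rule: bit_pair_cases) (auto simp: col_simps zero_prod_def)
  then show thesis using that by blast
qed

locale labelled_lagrangian = lagrangian E L + labelled E t
  for E :: "'a set" and L :: "('a \<Rightarrow> bit \<times> bit) set" and t :: "'a \<Rightarrow> 3 \<Rightarrow> 'u"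
begin

definition supp :: "('a \<Rightarrow> bit \<times> bit) \<Rightarrow> 'u set" where
  "supp v = {t e i |e i. e \<in> E \<and> v e = col i}"

text \<open>The isotropic tight 3-matroid of \<open>L\<close>: a subtransversal is independent when it contains the support
of no nonzero vector of \<open>L\<close>.\<close>

definition lag_matroid :: "'u multimatroid" where
  "lag_matroid = \<lparr>elements = (\<Union>e\<in>E. {t e 1, t e 2, t e 3}),
     skew_classes = {{t e 1, t e 2, t e 3} |e. e \<in> E},
     indep = {I. I \<subseteq> (\<Union>e\<in>E. range (t e)) \<and>
       (\<forall>e\<in>E. \<forall>i j. t e i \<in> I \<longrightarrow> t e j \<in> I \<longrightarrow> i = j) \<and>
       (\<forall>v\<in>L. supp v \<subseteq> I \<longrightarrow> v = (\<lambda>_. 0))}\<rparr>"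

lemma on_carrier_lag: "on_carrier lag_matroid"
  by (simp add: on_carrier_def lag_matroid_def)

lemma mem_supp: "e \<in> E \<Longrightarrow> t e i \<in> supp v \<longleftrightarrow> v e = col i"
  by (auto simp: supp_def t_eq_iff)

lemma supp_subset_iff: "supp v \<subseteq> I \<longleftrightarrow> (\<forall>e\<in>E. \<forall>i. v e = col i \<longrightarrow> t e i \<in> I)"
  by (auto simp: supp_def)

lemma supp_empty_iff:
  assumes "v \<in> L"
  shows "supp v = {} \<longleftrightarrow> v = (\<lambda>_. 0)"
proof
  assume empty: "supp v = {}"
  have "v e = 0" if "e \<in> E" for e
    using empty mem_supp[OF that] by (metis col_cases empty_iff)
  then show "v = (\<lambda>_. 0)"
    using vec_eqI[OF assms zero_mem] by blast
qed (auto simp: supp_def dest: sym)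

lemma supp_subset_select_iff: "supp v \<subseteq> select s \<longleftrightarrow> supported v (\<lambda>e. col (s e))"
proof -
  have "(\<forall>i. v e = col i \<longrightarrow> t e i \<in> select s) \<longleftrightarrow> v e = 0 \<or> v e = col (s e)" if "e \<in> E" for e
    using mem_select[OF that] by (metis col_cases col_eq_iff col_nonzero)
  then show ?thesis
    by (simp add: supp_subset_iff supported_def)
qed

lemma subtransversal_supp: "subtransversal lag_matroid (supp v)"
  unfolding subtransversal_iff[OF on_carrier_lag] by (auto simp: supp_def t_eq_iff)

lemma indep_lag_iff:
  "I \<in> indep lag_matroid \<longleftrightarrow> subtransversal lag_matroid I \<and> (\<forall>C\<in>supp ` L. C \<subseteq> I \<longrightarrow> C = {})"
  unfolding subtransversal_iff[OF on_carrier_lag] by (auto simp: lag_matroid_def supp_empty_iff)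

lemma select_indep_lag_iff: "select s \<in> indep lag_matroid \<longleftrightarrow> basis (\<lambda>e. col (s e))"
proof -
  have "subtransversal lag_matroid (select s)"
    using transversal_select[OF on_carrier_lag, of s] by (auto simp: transversal_def subtransversal_def)
  then show ?thesis
    by (auto simp: indep_lag_iff basis_def supp_subset_select_iff supp_empty_iff)
qed

text \<open>Where two vectors are both nonzero they have to agree: the sum of two distinct nonzero vectors
of the plane is the third one, whose label belongs to neither support.\<close>

lemma supp_add:
  assumes compatible: "\<And>e. e \<in> E \<Longrightarrow> v e = 0 \<or> w e = 0 \<or> v e = w e"
  shows "supp (\<lambda>e. v e + w e) = sym_diff (supp v) (supp w)"
proof -
  have "v e + w e = col i \<longleftrightarrow> (v e = col i) \<noteq> (w e = col i)" if "e \<in> E" for e i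
    using compatible[OF that] by (auto dest: sym)
  then have "t e i \<in> supp (\<lambda>e. v e + w e) \<longleftrightarrow> t e i \<in> sym_diff (supp v) (supp w)" if "e \<in> E" for e i
    using that by (auto simp: mem_supp)
  moreover have "supp u \<subseteq> (\<Union>e\<in>E. range (t e))" for u
    by (auto simp: supp_def)
  ultimately show ?thesis by blast
qed

lemma compatible_in_subtransversal:
  assumes I: "subtransversal lag_matroid I" and "supp v \<subseteq> I" "supp w \<subseteq> I" and e: "e \<in> E"
  shows "v e = 0 \<or> w e = 0 \<or> v e = w e"
proof (rule ccontr)
  assume con: "\<not> ?thesis"
  then obtain i j where ij: "v e = col i" "w e = col j"
    by (metis col_cases)
  then have "t e i \<in> I" "t e j \<in> I"
    using assms by (auto simp: supp_subset_iff)
  then have "i = j"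
    using I e unfolding subtransversal_iff[OF on_carrier_lag] by blast
  then show False using ij con by simp
qed

lemma matroid_lag_select: "matroid (select s, indep lag_matroid \<inter> Pow (select s))"
proof -
  have st: "subtransversal lag_matroid I" if "I \<subseteq> select s" for I
  proof -
    have "subtransversal lag_matroid (select s)"
      using transversal_select[OF on_carrier_lag, of s] by (auto simp: transversal_def subtransversal_def)
    then show ?thesis
      using that unfolding subtransversal_iff[OF on_carrier_lag] by blast
  qed
  have "indep lag_matroid \<inter> Pow (select s)
      = {I. I \<subseteq> select s \<and> (\<forall>C\<in>supp ` L. C \<subseteq> I \<longrightarrow> C = {})}"
  proof (rule set_eqI)
    fix I
    show "I \<in> indep lag_matroid \<inter> Pow (select s)
        \<longleftrightarrow> I \<in> {I. I \<subseteq> select s \<and> (\<forall>C\<in>supp ` L. C \<subseteq> I \<longrightarrow> C = {})}"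
      by (cases "I \<subseteq> select s") (simp_all add: st indep_lag_iff)
  qed
  moreover have "matroid (select s, {I. I \<subseteq> select s \<and> (\<forall>C\<in>supp ` L. C \<subseteq> I \<longrightarrow> C = {})})"
  proof (rule matroid_of_cycle_space)
    show "finite (select s)" using finite_ground by (simp add: select_def)
    show "{} \<in> supp ` L" using supp_empty_iff[OF zero_mem] zero_mem by (metis imageI)
  next
    fix C C' assume "C \<in> supp ` L" "C' \<in> supp ` L" and sub: "C \<subseteq> select s" "C' \<subseteq> select s"
    then obtain v w where vw: "v \<in> L" "w \<in> L" "C = supp v" "C' = supp w" by blast
    have eq: "supp (\<lambda>e. v e + w e) = sym_diff C C'"
      unfolding vw(3,4)
      by (rule supp_add) (rule compatible_in_subtransversal[OF st[OF order_refl] sub[unfolded vw(3,4)]])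
    show "sym_diff C C' \<in> supp ` L"
      by (rule image_eqI[where f = supp, OF eq[symmetric] add_mem[OF vw(1,2)]])
  qed
  ultimately show ?thesis by simp
qed

text \<open>Two obstructing vectors would agree, where both are nonzero, in all coordinates but \<open>e\<close>, against
isotropy.\<close>

lemma lag_extend:
  assumes I: "I \<in> indep lag_matroid" and e: "e \<in> E" "range (t e) \<inter> I = {}" and ij: "i \<noteq> j"
  shows "I \<union> {t e i} \<in> indep lag_matroid \<or> I \<union> {t e j} \<in> indep lag_matroid"
proof -
  have stI: "subtransversal lag_matroid I" using I by (simp add: indep_lag_iff)
  have dep: "\<exists>v\<in>L. v e = col k \<and> supp v \<subseteq> I \<union> {t e k}" if "I \<union> {t e k} \<notin> indep lag_matroid" for k
  proof -
    have "subtransversal lag_matroid (I \<union> {t e k})"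
      using stI e unfolding subtransversal_iff[OF on_carrier_lag] by (auto simp: t_eq_iff)
    then have "\<not> (\<forall>C\<in>supp ` L. C \<subseteq> I \<union> {t e k} \<longrightarrow> C = {})"
      using that unfolding indep_lag_iff by blast
    then obtain v where v: "v \<in> L" "supp v \<subseteq> I \<union> {t e k}" "supp v \<noteq> {}"
      by blast
    then have "\<not> supp v \<subseteq> I" using I unfolding indep_lag_iff by blast
    then have "t e k \<in> supp v" using v(2) by blast
    then show ?thesis using v e by (auto simp: mem_supp)
  qed
  show ?thesis
  proof (rule ccontr)
    assume "\<not> ?thesis"
    then obtain v w where v: "v \<in> L" "v e = col i" "supp v \<subseteq> I \<union> {t e i}"
      and w: "w \<in> L" "w e = col j" "supp w \<subseteq> I \<union> {t e j}"
      using dep by blast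
    have "v e = 0 \<or> w e = 0 \<or> v e = w e"
    proof (rule isotropic_at[OF v(1) w(1) e(1)])
      fix f assume f: "f \<in> E" "f \<noteq> e"
      show "v f = 0 \<or> w f = 0 \<or> v f = w f"
      proof (rule ccontr)
        assume con: "\<not> ?thesis"
        then obtain k l where kl: "v f = col k" "w f = col l"
          by (metis col_cases)
        then have "t f k \<in> I \<union> {t e i}" "t f l \<in> I \<union> {t e j}"
          using v(3) w(3) f by (auto simp: supp_subset_iff)
        then have "t f k \<in> I" "t f l \<in> I"
          using f e by (auto simp: t_eq_iff)
        then have "k = l"
          using stI f unfolding subtransversal_iff[OF on_carrier_lag] by blast
        then show False using kl con by simp
      qed
    qed
    then show False using v w ij by auto
  qed
qed

lemma multimatroid_lag: "multimatroid lag_matroid"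
  unfolding multimatroid_def
proof (intro conjI ballI allI impI)
  show "finite (elements lag_matroid)" by (rule finite_carrier[OF on_carrier_lag])
  show "partition_on (elements lag_matroid) (skew_classes lag_matroid)"
    by (rule partition_carrier[OF on_carrier_lag])
next
  fix I assume "I \<in> indep lag_matroid"
  then show "subtransversal lag_matroid I" by (simp add: indep_lag_iff)
next
  fix T assume "transversal lag_matroid T"
  then show "matroid (T, indep lag_matroid \<inter> Pow T)"
    using matroid_lag_select by (auto simp: transversal_iff[OF on_carrier_lag])
next
  fix I \<omega> x y
  assume I: "I \<in> indep lag_matroid" and "\<omega> \<in> skew_classes lag_matroid" "\<omega> \<inter> I = {}" "x \<in> \<omega>" "y \<in> \<omega>" "x \<noteq> y"
  then obtain e i j where "e \<in> E" "range (t e) \<inter> I = {}" "x = t e i" "y = t e j" "i \<noteq> j"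
    by (auto simp: on_carrier_eqs[OF on_carrier_lag])
  then show "I \<union> {x} \<in> indep lag_matroid \<or> I \<union> {y} \<in> indep lag_matroid"
    using lag_extend[OF I] by simp
qed

lemma tight_lag: "tight_3_matroid lag_matroid"
  unfolding tight_3_matroid_def
proof (intro conjI ballI)
  show "multimatroid lag_matroid" by (rule multimatroid_lag)
next
  fix \<omega> assume "\<omega> \<in> skew_classes lag_matroid"
  then show "card \<omega> = 3" by (rule card_skew_class[OF on_carrier_lag])
next
  fix B \<omega> assume B: "B \<in> bases lag_matroid" and "\<omega> \<in> skew_classes lag_matroid"
  then obtain e where e: "e \<in> E" "\<omega> = range (t e)"
    by (auto simp: on_carrier_eqs[OF on_carrier_lag])
  have bas: "select r \<in> bases lag_matroid \<longleftrightarrow> basis (\<lambda>e. col (r e))" for r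
    using bases_iff[OF on_carrier_lag multimatroid_lag] select_indep_lag_iff by blast
  obtain s where s: "B = select s"
    using B bases_iff[OF on_carrier_lag multimatroid_lag] by blast
  then have bs: "basis (\<lambda>e. col (s e))" using B bas by simp
  obtain v where v: "v \<in> L" "v e \<noteq> 0" "v e \<noteq> col (s e)"
    "\<And>f. f \<in> E \<Longrightarrow> f \<noteq> e \<Longrightarrow> v f = 0 \<or> v f = col (s f)"
    using fundamental_vector[OF bs col_nonzero e(1)] by blast
  obtain k where k: "v e = col k" using v(2) col_cases by blast
  have "B - \<omega> \<union> {t e j} \<in> bases lag_matroid \<longleftrightarrow> j \<noteq> k" for j
  proof -
    have "(\<lambda>f. col ((s(e := j)) f)) = (\<lambda>f. col (s f))(e := col j)"
      by (auto simp: fun_eq_iff)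
    then show ?thesis
      unfolding s e(2) select_update[OF e(1)] bas
      using basis_change_iff[OF bs v(1) e(1) v(2-4) col_nonzero, of j] k by simp
  qed
  then show "\<exists>!u. u \<in> \<omega> \<and> B - \<omega> \<union> {u} \<notin> bases lag_matroid"
    unfolding e(2) by (intro ex1I[of _ "t e k"]) auto
qed

text \<open>The labels 1 and 2 stand for \<open>(1, 0)\<close> and \<open>(0, 1)\<close>, so label 3 stands for their sum.\<close>

lemma system_of_lag: "system_of E t lag_matroid = sys (1, 0) (0, 1)"
proof (rule set_system_eqI)
  fix X :: "'a set"
  have "(\<lambda>e. col (if e \<in> X then 2 else 1)) = (\<lambda>e. if e \<in> X then (0, 1) else (1, 0))"
    by (auto simp: col_simps)
  then show "X \<in> feasible (system_of E t lag_matroid) \<longleftrightarrow> X \<in> feasible (sys (1, 0) (0, 1))"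
    by (simp only: feasible_system_of_iff[OF on_carrier_lag multimatroid_lag] select_indep_lag_iff feasible_sys)
qed (simp add: system_of_def)

lemma Z3_sys: "Z3 (sys (1, 0) (0, 1)) t = lag_matroid"
  unfolding Z3_def ground_sys
proof (rule the_equality)
  show "tight_3_matroid lag_matroid \<and> elements lag_matroid = (\<Union>e\<in>E. {t e 1, t e 2, t e 3}) \<and>
    skew_classes lag_matroid = {{t e 1, t e 2, t e 3} |e. e \<in> E} \<and>
    system_of E t lag_matroid = sys (1, 0) (0, 1)"
    using tight_lag on_carrier_lag system_of_lag by (simp add: on_carrier_def)
next
  fix Z :: "'u multimatroid"
  assume "tight_3_matroid Z \<and> elements Z = (\<Union>e\<in>E. {t e 1, t e 2, t e 3}) \<and>
    skew_classes Z = {{t e 1, t e 2, t e 3} |e. e \<in> E} \<and> system_of E t Z = sys (1, 0) (0, 1)"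
  then show "Z = lag_matroid"
    using system_of_lag
    by (intro tight_3_matroid_unique on_carrier_lag tight_lag) (simp_all add: on_carrier_def)
qed

section \<open>Parities of circuits\<close>

lemma circuits_lag: "circuits lag_matroid = min_members (supp ` L)"
proof (intro set_eqI iffI)
  fix C assume C: "C \<in> circuits lag_matroid"
  then have st: "subtransversal lag_matroid C" and dep: "C \<notin> indep lag_matroid"
    and mini: "\<And>C'. C' \<subset> C \<Longrightarrow> subtransversal lag_matroid C' \<Longrightarrow> C' \<in> indep lag_matroid"
    by (auto simp: circuits_def)
  have eq: "supp v = C" if "v \<in> L" "supp v \<noteq> {}" "supp v \<subseteq> C" for v
  proof (rule ccontr)
    assume "supp v \<noteq> C"
    then have "supp v \<in> indep lag_matroid"
      using that mini subtransversal_supp by blast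
    then show False using that by (auto simp: indep_lag_iff)
  qed
  moreover obtain v where "v \<in> L" "supp v \<noteq> {}" "supp v \<subseteq> C"
    using st dep by (auto simp: indep_lag_iff)
  ultimately show "C \<in> min_members (supp ` L)"
    by (auto simp: min_members_def)
next
  fix C assume "C \<in> min_members (supp ` L)"
  then have C: "C \<in> supp ` L" "C \<noteq> {}" "\<forall>C'\<in>supp ` L. C' \<noteq> {} \<and> C' \<subseteq> C \<longrightarrow> C' = C"
    by (auto simp: min_members_def)
  have "subtransversal lag_matroid C" using C(1) subtransversal_supp by blast
  moreover have "C \<notin> indep lag_matroid" using C(1,2) unfolding indep_lag_iff by blast
  moreover have "C' \<in> indep lag_matroid" if "C' \<subset> C" "subtransversal lag_matroid C'" for C'
    using that C(3) unfolding indep_lag_iff by blast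
  ultimately show "C \<in> circuits lag_matroid"
    by (simp add: circuits_def)
qed

text \<open>The parity condition with coefficients \<open>\<beta>\<close>, written as a sum of weights of the elements of a set, so
that it is additive on disjoint unions.\<close>

definition weight :: "bit ^ 3 \<Rightarrow> 'u \<Rightarrow> bit" where
  "weight \<beta> u = \<beta> $ 1 * of_bool (u \<in> T_class E t 1) + \<beta> $ 2 * of_bool (u \<in> T_class E t 2)
     + \<beta> $ 3 * of_bool (u \<in> T_class E t 3)"

lemma finite_supp: "finite (supp v)"
  using finite_carrier[OF on_carrier_lag] subtransversal_supp[of v] finite_subset
  by (auto simp: subtransversal_def)

lemma sum_weight:
  assumes "finite C"
  shows "sum (weight \<beta>) C = \<beta> $ 1 * of_nat (card (C \<inter> T_class E t 1))
    + \<beta> $ 2 * of_nat (card (C \<inter> T_class E t 2)) + \<beta> $ 3 * of_nat (card (C \<inter> T_class E t 3))"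
proof -
  have "(\<Sum>u\<in>C. of_bool (u \<in> T) :: bit) = of_nat (card (C \<inter> T))" for T
    using assms by (simp add: of_bool_def sum.If_cases)
  then show ?thesis
    unfolding weight_def by (simp only: sum.distrib sum_distrib_left[symmetric])
qed

lemma count_eq_card_supp: "of_nat (card (supp v \<inter> T_class E t i)) = count (col i) v"
proof -
  have "supp v \<inter> T_class E t i = (\<lambda>e. t e i) ` {e \<in> E. v e = col i}"
    by (auto simp: supp_def T_class_def t_eq_iff)
  moreover have "inj_on (\<lambda>e. t e i) {e \<in> E. v e = col i}"
    by (auto simp: inj_on_def t_eq_iff)
  ultimately have "card (supp v \<inter> T_class E t i) = card {e \<in> E. v e = col i}"
    by (simp add: card_image)
  moreover have "count (col i) v = of_nat (card {e \<in> E. v e = col i})"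
    using finite_ground by (simp add: count_def of_bool_def sum.If_cases Int_def)
  ultimately show ?thesis by simp
qed

text \<open>The supports of the vectors of \<open>L\<close> are closed under relative differences and their minimal nonempty
members are the circuits, so the vanishing of the weight passes from the circuits to all supports.\<close>

theorem P_cond_iff:
  "P_cond \<beta> (sys (1, 0) (0, 1)) t \<longleftrightarrow>
    (\<forall>v\<in>L. \<beta> $ 1 * count (col 1) v + \<beta> $ 2 * count (col 2) v + \<beta> $ 3 * count (col 3) v = 0)"
proof -
  have "P_cond \<beta> (sys (1, 0) (0, 1)) t \<longleftrightarrow> (\<forall>C\<in>min_members (supp ` L). sum (weight \<beta>) C = 0)"
  proof -
    have "finite C" if "C \<in> min_members (supp ` L)" for C
      using that finite_supp by (auto simp: min_members_def)
    then show ?thesis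
      by (simp add: P_cond_def Z3_sys circuits_lag parity_def sum_weight)
  qed
  also have "\<dots> \<longleftrightarrow> (\<forall>C\<in>supp ` L. sum (weight \<beta>) C = 0)"
  proof
    assume zero: "\<forall>C\<in>min_members (supp ` L). sum (weight \<beta>) C = 0"
    show "\<forall>C\<in>supp ` L. sum (weight \<beta>) C = 0"
    proof
      fix C assume "C \<in> supp ` L"
      then show "sum (weight \<beta>) C = 0"
      proof (rule weight_zero_if_zero_on_min_members[rotated 3])
        fix C C' assume "C \<in> supp ` L" "C' \<in> supp ` L" and sub: "C' \<subseteq> C"
        then obtain v w where vw: "v \<in> L" "w \<in> L" "C = supp v" "C' = supp w" by blast
        have "supp (\<lambda>e. v e + w e) = sym_diff C C'"
          unfolding vw(3,4) using sub unfolding vw(3,4)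
          by (intro supp_add compatible_in_subtransversal[OF subtransversal_supp[of v]]) auto
        also have "\<dots> = C - C'" using sub by blast
        finally have "C - C' = supp (\<lambda>e. v e + w e)" by (rule sym)
        then show "C - C' \<in> supp ` L"
          by (rule image_eqI[where f = supp, OF _ add_mem[OF vw(1,2)]])
      qed (use finite_supp zero in auto)
    qed
  qed (auto simp: min_members_def)
  also have "\<dots> \<longleftrightarrow>
      (\<forall>v\<in>L. \<beta> $ 1 * count (col 1) v + \<beta> $ 2 * count (col 2) v + \<beta> $ 3 * count (col 3) v = 0)"
    using finite_supp by (simp add: sum_weight count_eq_card_supp)
  finally show ?thesis .
qed

text \<open>Every element of the carrier lies in exactly one of \<open>T\<^sub>1\<close>, \<open>T\<^sub>2\<close>, \<open>T\<^sub>3\<close>, so it has weight 1 for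
\<open>\<beta> = (1, 1, 1)\<close>.\<close>

lemma Z3_bipartite_iff:
  "Z3_bipartite (sys (1, 0) (0, 1)) t \<longleftrightarrow> P_cond (vector [1, 1, 1]) (sys (1, 0) (0, 1)) t"
proof -
  have "even (card C) \<longleftrightarrow> parity (sys (1, 0) (0, 1)) t 1 C + parity (sys (1, 0) (0, 1)) t 2 C
      + parity (sys (1, 0) (0, 1)) t 3 C = 0" if "C \<in> circuits lag_matroid" for C
  proof -
    have C: "C \<subseteq> (\<Union>e\<in>E. range (t e))" "finite C"
    proof -
      obtain v where "C = supp v" using \<open>C \<in> circuits lag_matroid\<close> by (auto simp: circuits_lag min_members_def)
      then show "C \<subseteq> (\<Union>e\<in>E. range (t e))" "finite C"
        using finite_supp by (auto simp: supp_def)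
    qed
    have one: "weight (vector [1, 1, 1]) u = 1" if u: "u \<in> C" for u
    proof -
      obtain e i where e: "e \<in> E" "u = t e i" using C u by blast
      have mem: "u \<in> T_class E t j \<longleftrightarrow> i = j" for j
        unfolding T_class_def e(2) using e(1) by (auto simp: t_eq_iff)
      have "i = 1 \<or> i = 2 \<or> i = 3" by (rule exhaust_3)
      then show ?thesis
        unfolding weight_def mem vector_3 by (elim disjE) simp_all
    qed
    have "(of_nat (card C) :: bit) = (\<Sum>u\<in>C. 1)" by simp
    also have "\<dots> = sum (weight (vector [1, 1, 1])) C"
      using one by (intro sum.cong) auto
    finally have eq: "(of_nat (card C) :: bit) = sum (weight (vector [1, 1, 1])) C" .
    have "even (card C) \<longleftrightarrow> (of_nat (card C) :: bit) = 0"
      by (simp add: of_nat_bit_eq)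
    then have "even (card C) \<longleftrightarrow> sum (weight (vector [1, 1, 1])) C = 0"
      by (simp only: eq)
    then show ?thesis
      by (simp only: sum_weight[OF C(2)] vector_3 mult_1_left parity_def ground_sys)
  qed
  then show ?thesis
    by (simp add: Z3_bipartite_def P_cond_def Z3_sys)
qed

end

section \<open>The seven properties\<close>

lemma bit_vec3_cases:
  fixes \<beta> :: "bit ^ 3"
  obtains "\<beta> = 0" | "\<beta> = vector [0, 0, 1]" | "\<beta> = vector [0, 1, 0]" | "\<beta> = vector [0, 1, 1]"
    | "\<beta> = vector [1, 0, 0]" | "\<beta> = vector [1, 0, 1]" | "\<beta> = vector [1, 1, 0]" | "\<beta> = vector [1, 1, 1]"
proof -
  have "\<beta> = vector [\<beta> $ 1, \<beta> $ 2, \<beta> $ 3]"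
    by (simp add: vec_eq_iff forall_3)
  moreover have "vector [0, 0, 0] = (0 :: bit ^ 3)"
    by (simp add: vec_eq_iff forall_3)
  ultimately show thesis
    using that by (cases "\<beta> $ 1"; cases "\<beta> $ 2"; cases "\<beta> $ 3") metis+
qed

theorem theorem4p2:
  fixes D :: "'a set_system" and t :: "'a \<Rightarrow> 3 \<Rightarrow> 'u"
  assumes "delta_matroid D" and "binary D" and "labelling (ground D) t"
  shows "vec.subspace (X_set D t) \<and>
    {\<beta> :: bit ^ 3.
       (\<beta> = vector [0, 0, 1] \<and> even_system D) \<or>
       (\<beta> = vector [0, 1, 0] \<and> even_system (plus_all D)) \<or>
       (\<beta> = vector [0, 1, 1] \<and> bipartite D) \<or>
       (\<beta> = vector [1, 0, 0] \<and> even_system (plus_all (dual D))) \<or>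
       (\<beta> = vector [1, 0, 1] \<and> bipartite (dual D)) \<or>
       (\<beta> = vector [1, 1, 0] \<and> bipartite (dual (plus_all D))) \<or>
       (\<beta> = vector [1, 1, 1] \<and> Z3_bipartite D t)}
    = X_set D t - {0}"
proof -
  obtain L where lag: "lagrangian (ground D) L"
    and D: "D = lagrangian.sys (ground D) L (1, 0) (0, 1)"
    using binary_imp_sys[OF assms(1,2)] .
  interpret lagrangian "ground D" L by (rule lag)
  interpret labelled_lagrangian "ground D" L t
    using finite_E assms(3) by unfold_locales
  note D' = D[symmetric]
  have nz: "(1, 0) \<noteq> (0 :: bit \<times> bit)" "(0, 1) \<noteq> (0 :: bit \<times> bit)" "(1, 1) \<noteq> (0 :: bit \<times> bit)"
    by (auto simp: zero_prod_def)
  have P: "P_cond \<beta> D t \<longleftrightarrow>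
      (\<forall>v\<in>L. \<beta> $ 1 * count (1, 0) v + \<beta> $ 2 * count (0, 1) v + \<beta> $ 3 * count (1, 1) v = 0)" for \<beta>
    using P_cond_iff[of \<beta>] by (simp only: col_simps D')
  have dualD: "dual D = sys (0, 1) (1, 0)"
    using dual_sys[of "(1, 0)" "(0, 1)"] by (simp only: D')
  have plusD: "plus_all D = sys (1, 0) (1, 1)"
    using plus_all_sys[of "(1, 0)" "(0, 1)"] nz by (simp add: D')
  have plus_dualD: "plus_all (dual D) = sys (0, 1) (1, 1)"
    unfolding dualD using plus_all_sys[of "(0, 1)" "(1, 0)"] nz by simp
  have dual_plusD: "dual (plus_all D) = sys (1, 1) (1, 0)"
    unfolding plusD by (rule dual_sys)
  have 1: "even_system D \<longleftrightarrow> P_cond (vector [0, 0, 1]) D t"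
    using even_sys_iff[of "(1, 0)" "(0, 1)"] nz by (simp add: D' P)
  have 2: "even_system (plus_all D) \<longleftrightarrow> P_cond (vector [0, 1, 0]) D t"
    using even_sys_iff[of "(1, 0)" "(1, 1)"] nz by (simp add: plusD P)
  have 3: "bipartite D \<longleftrightarrow> P_cond (vector [0, 1, 1]) D t"
    using bipartite_sys_iff[of "(1, 0)" "(0, 1)"] nz by (simp add: D' P)
  have 4: "even_system (plus_all (dual D)) \<longleftrightarrow> P_cond (vector [1, 0, 0]) D t"
    using even_sys_iff[of "(0, 1)" "(1, 1)"] nz by (simp add: plus_dualD P)
  have 5: "bipartite (dual D) \<longleftrightarrow> P_cond (vector [1, 0, 1]) D t"
    using bipartite_sys_iff[of "(0, 1)" "(1, 0)"] nz by (simp add: dualD P)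
  have 6: "bipartite (dual (plus_all D)) \<longleftrightarrow> P_cond (vector [1, 1, 0]) D t"
    using bipartite_sys_iff[of "(1, 1)" "(1, 0)"] nz by (simp add: dual_plusD P)
  have 7: "Z3_bipartite D t \<longleftrightarrow> P_cond (vector [1, 1, 1]) D t"
    using Z3_bipartite_iff by (simp only: D')
  have subspace: "vec.subspace (X_set D t)"
  proof -
    have add: "(\<beta> + \<gamma>) $ 1 * a + (\<beta> + \<gamma>) $ 2 * b + (\<beta> + \<gamma>) $ 3 * c
        = (\<beta> $ 1 * a + \<beta> $ 2 * b + \<beta> $ 3 * c) + (\<gamma> $ 1 * a + \<gamma> $ 2 * b + \<gamma> $ 3 * c)"
      for \<beta> \<gamma> :: "bit ^ 3" and a b c
      by (simp only: vector_add_component distrib_left distrib_right ac_simps)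
    have scale: "(k *s \<beta>) $ 1 * a + (k *s \<beta>) $ 2 * b + (k *s \<beta>) $ 3 * c
        = k * (\<beta> $ 1 * a + \<beta> $ 2 * b + \<beta> $ 3 * c)" for \<beta> :: "bit ^ 3" and k a b c
      by (simp only: vector_smult_component distrib_left mult.assoc)
    show ?thesis
      unfolding vec.subspace_def X_set_def mem_Collect_eq P add scale by simp
  qed
  have nonzero: "vector [0, 0, 1] \<noteq> (0 :: bit ^ 3)" "vector [0, 1, 0] \<noteq> (0 :: bit ^ 3)"
    "vector [0, 1, 1] \<noteq> (0 :: bit ^ 3)" "vector [1, 0, 0] \<noteq> (0 :: bit ^ 3)"
    "vector [1, 0, 1] \<noteq> (0 :: bit ^ 3)" "vector [1, 1, 0] \<noteq> (0 :: bit ^ 3)"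
    "vector [1, 1, 1] \<noteq> (0 :: bit ^ 3)"
    by (simp_all add: vec_eq_iff forall_3)
  have mem: "\<beta> \<in> {\<beta> :: bit ^ 3.
       (\<beta> = vector [0, 0, 1] \<and> even_system D) \<or>
       (\<beta> = vector [0, 1, 0] \<and> even_system (plus_all D)) \<or>
       (\<beta> = vector [0, 1, 1] \<and> bipartite D) \<or>
       (\<beta> = vector [1, 0, 0] \<and> even_system (plus_all (dual D))) \<or>
       (\<beta> = vector [1, 0, 1] \<and> bipartite (dual D)) \<or>
       (\<beta> = vector [1, 1, 0] \<and> bipartite (dual (plus_all D))) \<or>
       (\<beta> = vector [1, 1, 1] \<and> Z3_bipartite D t)} \<longleftrightarrow> \<beta> \<in> X_set D t - {0}" for \<beta>
  proof -
    have "\<beta> = 0 \<or> \<beta> = vector [0, 0, 1] \<or> \<beta> = vector [0, 1, 0] \<or> \<beta> = vector [0, 1, 1]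
      \<or> \<beta> = vector [1, 0, 0] \<or> \<beta> = vector [1, 0, 1] \<or> \<beta> = vector [1, 1, 0] \<or> \<beta> = vector [1, 1, 1]"
      by (cases \<beta> rule: bit_vec3_cases) blast+
    then have nz_iff: "\<beta> \<noteq> 0 \<longleftrightarrow> \<beta> = vector [0, 0, 1] \<or> \<beta> = vector [0, 1, 0] \<or> \<beta> = vector [0, 1, 1]
      \<or> \<beta> = vector [1, 0, 0] \<or> \<beta> = vector [1, 0, 1] \<or> \<beta> = vector [1, 1, 0] \<or> \<beta> = vector [1, 1, 1]"
      using nonzero by auto
    have move: "\<beta> = v \<and> P_cond v D t \<longleftrightarrow> P_cond \<beta> D t \<and> \<beta> = v" for v
      by auto
    show ?thesis
      unfolding 1 2 3 4 5 6 7 X_set_def mem_Collect_eq Diff_iff singleton_iff nz_iff move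
      by (simp only: conj_disj_distribL)
  qed
  show ?thesis
    by (intro conjI subspace set_eqI mem)
qed

end
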